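(* Let $R(z)=R_0+zC(I-zA)^{-1}B+\gamma(zI-\alpha)^{-1}\beta$ be an $m\times m$ rational matrix function with $A$ and $\alpha$ stable and with no poles and no zeros on the unit circle $\mathbb{T}$. Let $\widetilde A,\widetilde B,\widetilde C,\widetilde D,Q,D,A_0,B_0,C_0$ be the matrices defined from this realization in the context. Then the matrix $A_0$ is stable and $R^*(z)R(z)=\Psi^*(z)\Psi(z)$, where $\Psi(z)$ is the invertible outer function given by \[ \Psi(z)=D+zD^{-1}C_0(I-z\widetilde A^* )^{-1}B_0, \] and the inverse of $\Psi(z)$ is given by \[ \Psi(z)^{-1}=D^{-1}-zD^{-2}C_0(I-zA_0)^{-1}B_0D^{-1}. \]
   Context: All matrices are complex; a square matrix is stable if all its eigenvalues lie in the open unit disc. For a rational matrix function $F(z)$, $F^*(z)=F(1/\bar z)^*$. Zeros of a square rational matrix function are the poles of its inverse. An invertible outer function is a rational $m\times m$ matrix function with no poles and no zeros on the closed unit disc. The realization of $R$ is not required to be minimal. Let $P_+$ and $P_-$ be the unique solutions of $P_+-A^*P_+A=C^*C$ and $P_--\alpha^*P_-\alpha=\gamma^*\gamma$. Put \[ \widetilde A=\begin{bmatrix}A^*& C^*\gamma\\0&\alpha\end{bmatrix},\quad \widetilde B=\begin{bmatrix}C^*R_0+A^*P_+B\\ \beta\end{bmatrix},\quad \widetilde C=\begin{bmatrix}B^*& R_0^*\gamma+\beta^*P_-\alpha\end{bmatrix},\quad \widetilde D=R_0^*R_0+B^*P_+B+\beta^*P_-\beta. \] Let $Q$ be the unique stabilizing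 solution of the algebraic Riccati equation \[ Q-\widetilde AQ\widetilde A^*=(\widetilde B-\widetilde AQ\widetilde C^* )(\widetilde D-\widetilde CQ\widetilde C^* )^{-1}(\widetilde B^*-\widetilde CQ\widetilde A^* ), \] i.e. the Hermitian solution for which $\widetilde D-\widetilde CQ\widetilde C^*$ is positive definite and $\widetilde A^*-\widetilde C^*(\widetilde D-\widetilde CQ\widetilde C^* )^{-1}(\widetilde B^*-\widetilde CQ\widetilde A^* )$ is stable (such a $Q$ exists and is unique). Define \[ D=(\widetilde D-\widetilde CQ\widetilde C^* )^{1/2},\quad C_0=\widetilde B^*-\widetilde CQ\widetilde A^*,\quad B_0=\widetilde C^*,\quad A_0=\widetilde A^*-\widetilde C^*D^{-2}C_0 . \] *)

theory Defs
  imports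
    "HOL-Complex_Analysis.Complex_Analysis"
    "Jordan_Normal_Form.Schur_Decomposition"
begin

text \<open>
  Matrices are those of \<open>Jordan_Normal_Form\<close>, so that the state dimensions are
  natural numbers and may be \<open>0\<close>.
\<close>

notation mat_adjoint (\<open>_\<^sup>\<dagger>\<close> [1000] 999)

text \<open>Unspecified for singular arguments.\<close>

definition mat_inv :: "complex mat \<Rightarrow> complex mat" where
  "mat_inv M = the (mat_inverse M)"

definition stable_mat :: "complex mat \<Rightarrow> bool" where
  "stable_mat M \<longleftrightarrow> square_mat M \<and> (\<forall>k. eigenvalue M k \<longrightarrow> cmod k < 1)"

definition pos_def_mat :: "complex mat \<Rightarrow> bool" where
  "pos_def_mat M \<longleftrightarrow> square_mat M \<and> M\<^sup>\<dagger> = M \<and>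
     (\<forall>v \<in> carrier_vec (dim_row M). v \<noteq> 0\<^sub>v (dim_row M) \<longrightarrow> Re ((M *\<^sub>v v) \<bullet>c v) > 0)"

definition hstack :: "complex mat \<Rightarrow> complex mat \<Rightarrow> complex mat" where
  "hstack M N = four_block_mat M N (0\<^sub>m 0 (dim_col M)) (0\<^sub>m 0 (dim_col N))"


text \<open>
  A rational function is represented by a total function on the complex plane whose
  values at the zeros of some denominator are arbitrary. Poles do not depend on these
  finitely many values, since \<open>is_pole\<close> only looks at punctured neighbourhoods.
\<close>

definition rational_fun :: "(complex \<Rightarrow> complex) \<Rightarrow> bool" where
  "rational_fun f \<longleftrightarrow>
     (\<exists>p q. q \<noteq> 0 \<and> (\<forall>z. poly q z \<noteq> 0 \<longrightarrow> f z = poly p z / poly q z))"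

definition rational_mat_fun :: "nat \<Rightarrow> (complex \<Rightarrow> complex mat) \<Rightarrow> bool" where
  "rational_mat_fun m F \<longleftrightarrow>
     (\<forall>z. F z \<in> carrier_mat m m) \<and> (\<forall>i<m. \<forall>j<m. rational_fun (\<lambda>z. F z $$ (i, j)))"

definition is_mat_pole :: "nat \<Rightarrow> (complex \<Rightarrow> complex mat) \<Rightarrow> complex \<Rightarrow> bool" where
  "is_mat_pole m F w \<longleftrightarrow> (\<exists>i<m. \<exists>j<m. is_pole (\<lambda>z. F z $$ (i, j)) w)"

definition no_poles_on :: "nat \<Rightarrow> (complex \<Rightarrow> complex mat) \<Rightarrow> complex set \<Rightarrow> bool" where
  "no_poles_on m F S \<longleftrightarrow> (\<forall>w\<in>S. \<not> is_mat_pole m F w)"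

text \<open>
  Zeros are the poles of the inverse. The finiteness condition says that the inverse exists
  as a rational matrix function, i.e. that the determinant is not identically zero.
\<close>

definition no_zeros_on :: "nat \<Rightarrow> (complex \<Rightarrow> complex mat) \<Rightarrow> complex set \<Rightarrow> bool" where
  "no_zeros_on m F S \<longleftrightarrow>
     finite {z. \<not> invertible_mat (F z)} \<and> no_poles_on m (\<lambda>z. mat_inv (F z)) S"

definition invertible_outer :: "nat \<Rightarrow> (complex \<Rightarrow> complex mat) \<Rightarrow> bool" where
  "invertible_outer m F \<longleftrightarrow>
     rational_mat_fun m F \<and> no_poles_on m F (cball 0 1) \<and> no_zeros_on m F (cball 0 1)"

definition para_adjoint :: "(complex \<Rightarrow> complex mat) \<Rightarrow> complex \<Rightarrow> complex mat" where
  "para_adjoint F z = (F (1 / cnj z))\<^sup>\<dagger>"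


definition stabilizing_solution ::
  "complex mat \<Rightarrow> complex mat \<Rightarrow> complex mat \<Rightarrow> complex mat \<Rightarrow> complex mat \<Rightarrow> bool" where
  "stabilizing_solution A B C D Q \<longleftrightarrow>
     Q \<in> carrier_mat (dim_row A) (dim_row A) \<and> Q\<^sup>\<dagger> = Q \<and>
     Q - A * Q * A\<^sup>\<dagger> =
       (B - A * Q * C\<^sup>\<dagger>) * mat_inv (D - C * Q * C\<^sup>\<dagger>) * (B\<^sup>\<dagger> - C * Q * A\<^sup>\<dagger>) \<and>
     pos_def_mat (D - C * Q * C\<^sup>\<dagger>) \<and>
     stable_mat (A\<^sup>\<dagger> - C\<^sup>\<dagger> * mat_inv (D - C * Q * C\<^sup>\<dagger>) * (B\<^sup>\<dagger> - C * Q * A\<^sup>\<dagger>))"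

end

theory Submission
  imports Defs
begin

text \<open>
  Put \<open>u = 1/z\<close>. Written with resolvents, \<open>R(z)\<close> is
  \<open>R\<^sub>0 + C (u - A)\<^bsup>-1\<^esup> B + \<gamma> (z - \<alpha>)\<^bsup>-1\<^esup> \<beta>\<close>, and \<open>R*(z)\<close> is a similar sum with the resolvents of
  \<open>A\<^sup>\<dagger>\<close> at \<open>z\<close> and of \<open>\<alpha>\<^sup>\<dagger>\<close> at \<open>u\<close>. The whole proof rests on one identity
  (\<open>resolvent_product\<close>): if \<open>X - F X G = W\<close> and \<open>z u = 1\<close>, then
  \<open>(z - F)\<^bsup>-1\<^esup> W (u - G)\<^bsup>-1\<^esup> = X + (z - F)\<^bsup>-1\<^esup> F X + X G (u - G)\<^bsup>-1\<^esup>\<close>,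
  so a product of a function of \<open>z\<close> and a function of \<open>1/z\<close> becomes a sum.

  Applied with \<open>P\<^sub>+\<close> and \<open>P\<^sub>-\<close> it turns \<open>R*(z) R(z)\<close> into
  \<open>Dt + Ct (z - At)\<^bsup>-1\<^esup> Bt + Bt\<^sup>\<dagger> (u - At\<^sup>\<dagger>)\<^bsup>-1\<^esup> Ct\<^sup>\<dagger>\<close> (\<open>two_sided_gram\<close>, with
  \<open>resolvent_block_upper\<close> for the block triangular \<open>At\<close>). For the last term to be the para-adjoint
  of the middle one, \<open>P\<^sub>+\<close> and \<open>P\<^sub>-\<close> must be Hermitian, which follows from uniqueness in the Stein
  equations (\<open>stein_equation_hermitian\<close>). Applied with \<open>Q\<close> the identity gives the same
  expression for \<open>\<Psi>*(z) \<Psi>(z)\<close>, because the Riccati equation identifies \<open>C\<^sub>0\<^sup>\<dagger> D\<^bsup>-2\<^esup> C\<^sub>0\<close> with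
  \<open>Q - At Q At\<^sup>\<dagger>\<close> (\<open>riccati_factor_gram\<close>).

  The formula for the inverse of \<open>\<Psi>\<close> is the usual state space inversion (\<open>realization_inverse\<close>),
  and \<open>A\<^sub>0\<close> is stable because \<open>Q\<close> is stabilizing. Since \<open>A\<close>, \<open>\<alpha>\<close> and \<open>A\<^sub>0\<close> are
  stable, both \<open>\<Psi>\<close> and its inverse are given by realizations without poles in the closed disc
  (\<open>invertible_outer_realization\<close>).
\<close>

section \<open>Ring laws for rectangular matrices\<close>

lemma assoc_mult_mat_dim:
  fixes A :: "'a :: semiring_0 mat"
  shows "dim_col A = dim_row B \<Longrightarrow> dim_col B = dim_row C \<Longrightarrow> A * B * C = A * (B * C)"
  by (rule assoc_mult_mat[of _ "dim_row A" "dim_col A" _ "dim_col B" _ "dim_col C"]) auto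

lemma add_mult_distrib_mat_dim:
  fixes A :: "'a :: semiring_0 mat"
  shows "dim_row A = dim_row B \<Longrightarrow> dim_col A = dim_col B \<Longrightarrow> dim_col B = dim_row C
    \<Longrightarrow> (A + B) * C = A * C + B * C"
  by (rule add_mult_distrib_mat[of _ "dim_row A" "dim_col A" _ _ "dim_col C"]) auto

lemma mult_add_distrib_mat_dim:
  fixes A :: "'a :: semiring_0 mat"
  shows "dim_row B = dim_row C \<Longrightarrow> dim_col B = dim_col C \<Longrightarrow> dim_col A = dim_row B
    \<Longrightarrow> A * (B + C) = A * B + A * C"
  by (rule mult_add_distrib_mat[of _ "dim_row A" "dim_col A" _ "dim_col B"]) auto

lemma minus_mult_distrib_mat_dim:
  fixes A :: "'a :: ring mat"
  shows "dim_row A = dim_row B \<Longrightarrow> dim_col A = dim_col B \<Longrightarrow> dim_col B = dim_row C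
    \<Longrightarrow> (A - B) * C = A * C - B * C"
  by (rule minus_mult_distrib_mat[of _ "dim_row A" "dim_col A" _ _ "dim_col C"]) auto

lemma mult_minus_distrib_mat_dim:
  fixes A :: "'a :: ring mat"
  shows "dim_row B = dim_row C \<Longrightarrow> dim_col B = dim_col C \<Longrightarrow> dim_col A = dim_row B
    \<Longrightarrow> A * (B - C) = A * B - A * C"
  by (rule mult_minus_distrib_mat[of _ "dim_row A" "dim_col A" _ "dim_col B"]) auto

lemma smult_mult_mat_dim:
  fixes A :: "'a :: comm_semiring_0 mat"
  shows "dim_col A = dim_row B \<Longrightarrow> (k \<cdot>\<^sub>m A) * B = k \<cdot>\<^sub>m (A * B)"
  by (rule mult_smult_assoc_mat[of _ "dim_row A" "dim_col A" _ "dim_col B"]) auto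

lemma mult_smult_mat_dim:
  fixes A :: "'a :: comm_semiring_0 mat"
  shows "dim_col A = dim_row B \<Longrightarrow> A * (k \<cdot>\<^sub>m B) = k \<cdot>\<^sub>m (A * B)"
  by (rule mult_smult_distrib[of _ "dim_row A" "dim_col A" _ "dim_col B"]) auto

lemma smult_add_mat_dim:
  fixes A :: "'a :: semiring mat"
  shows "dim_row A = dim_row B \<Longrightarrow> dim_col A = dim_col B \<Longrightarrow> k \<cdot>\<^sub>m (A + B) = k \<cdot>\<^sub>m A + k \<cdot>\<^sub>m B"
  by (rule eq_matI) (auto simp: distrib_left)

lemma smult_smult_mat:
  fixes A :: "'a :: semigroup_mult mat"
  shows "k \<cdot>\<^sub>m (l \<cdot>\<^sub>m A) = (k * l) \<cdot>\<^sub>m A"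
  by (rule eq_matI) (auto simp: mult.assoc)

lemma one_smult_mat: "1 \<cdot>\<^sub>m A = (A :: 'a :: monoid_mult mat)"
  by (rule eq_matI) auto

lemma add_assoc_mat_dim:
  fixes A :: "'a :: semigroup_add mat"
  shows "dim_row B = dim_row C \<Longrightarrow> dim_col B = dim_col C \<Longrightarrow> A + B + C = A + (B + C)"
  by (rule eq_matI) (auto simp: add.assoc)

lemma add_commute_mat_dim:
  fixes A :: "'a :: ab_semigroup_add mat"
  shows "dim_row A = dim_row B \<Longrightarrow> dim_col A = dim_col B \<Longrightarrow> A + B = B + A"
  by (rule eq_matI) (auto simp: add.commute)

lemma add_left_commute_mat_dim:
  fixes A :: "'a :: ab_semigroup_add mat"
  shows "dim_row A = dim_row B \<Longrightarrow> dim_col A = dim_col B \<Longrightarrow>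
    dim_row B = dim_row C \<Longrightarrow> dim_col B = dim_col C \<Longrightarrow> A + (B + C) = B + (A + C)"
  by (rule eq_matI) (auto simp: add.left_commute)

lemma add_right_cancel_mat_dim:
  fixes A :: "'a :: cancel_semigroup_add mat"
  assumes "A + C = B + C" "dim_row A = dim_row C" "dim_col A = dim_col C"
    "dim_row B = dim_row C" "dim_col B = dim_col C"
  shows "A = B"
proof (rule eq_matI)
  fix i j assume "i < dim_row B" "j < dim_col B"
  then have "(A + C) $$ (i,j) = A $$ (i,j) + C $$ (i,j)" "(B + C) $$ (i,j) = B $$ (i,j) + C $$ (i,j)"
    using assms(2-5) by auto
  then show "A $$ (i,j) = B $$ (i,j)" using assms(1) by (metis add_right_cancel)
qed (use assms in auto)

lemma diff_eq_iff_mat_dim: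
  fixes A :: "'a :: group_add mat"
  assumes "dim_row A = dim_row B" "dim_col A = dim_col B" "dim_row C = dim_row B" "dim_col C = dim_col B"
  shows "A - B = C \<longleftrightarrow> A = C + B"
proof
  assume "A - B = C"
  then show "A = C + B" using assms by (intro eq_matI) auto
next
  assume "A = C + B"
  then show "A - B = C" using assms by (intro eq_matI) auto
qed

lemma left_mult_one_mat_dim: "dim_row A = n \<Longrightarrow> 1\<^sub>m n * A = (A :: 'a :: semiring_1 mat)"
  by (rule left_mult_one_mat[of _ _ "dim_col A"]) auto

lemma right_mult_one_mat_dim: "dim_col A = n \<Longrightarrow> A * 1\<^sub>m n = (A :: 'a :: semiring_1 mat)"
  by (rule right_mult_one_mat[of _ "dim_row A"]) auto

lemma add_zero_mat_dim:
  fixes A :: "'a :: monoid_add mat"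
  shows "dim_row A = r \<Longrightarrow> dim_col A = c \<Longrightarrow> A + 0\<^sub>m r c = A"
  by (rule eq_matI) auto

text \<open>
  Matrices of varying shape do not form a ring type, so the ring laws need shape conditions. Phrased
  with \<open>dim_row\<close> and \<open>dim_col\<close> of the operands these contain no variables beyond those of the
  left-hand side, and the simplifier can discharge them while it normalizes; with carrier
  sets it would have to guess the inner dimensions. The collection normalizes sums of products.
\<close>
named_theorems mat_ring

lemmas [mat_ring] = assoc_mult_mat_dim add_mult_distrib_mat_dim mult_add_distrib_mat_dim
  smult_mult_mat_dim mult_smult_mat_dim smult_add_mat_dim smult_smult_mat
  add_assoc_mat_dim add_commute_mat_dim add_left_commute_mat_dim
  left_mult_one_mat_dim right_mult_one_mat_dim

section \<open>Adjoints and inverses\<close>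

lemma adjoint_dims [simp]: "dim_row (M\<^sup>\<dagger>) = dim_col M" "dim_col (M\<^sup>\<dagger>) = dim_row M"
  by (auto simp: mat_adjoint_def)

lemma adjoint_index [simp]:
  fixes M :: "complex mat"
  shows "i < dim_col M \<Longrightarrow> j < dim_row M \<Longrightarrow> M\<^sup>\<dagger> $$ (i,j) = cnj (M $$ (j,i))"
  by (simp add: mat_adjoint_def mat_of_rows_index)

lemma adjoint_carrier [simp]: "M \<in> carrier_mat r c \<Longrightarrow> M\<^sup>\<dagger> \<in> carrier_mat c r"
  by (intro carrier_matI) auto

lemma adjoint_adjoint [simp]: "(M\<^sup>\<dagger>)\<^sup>\<dagger> = (M :: complex mat)"
  by (rule eq_matI) auto

lemma adjoint_add:
  fixes M :: "complex mat"
  shows "dim_row M = dim_row N \<Longrightarrow> dim_col M = dim_col N \<Longrightarrow> (M + N)\<^sup>\<dagger> = M\<^sup>\<dagger> + N\<^sup>\<dagger>"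
  by (rule eq_matI) auto

lemma adjoint_minus:
  fixes M :: "complex mat"
  shows "dim_row M = dim_row N \<Longrightarrow> dim_col M = dim_col N \<Longrightarrow> (M - N)\<^sup>\<dagger> = M\<^sup>\<dagger> - N\<^sup>\<dagger>"
  by (rule eq_matI) auto

lemma adjoint_smult: "(k \<cdot>\<^sub>m M)\<^sup>\<dagger> = cnj k \<cdot>\<^sub>m M\<^sup>\<dagger>"
  by (rule eq_matI) auto

lemma adjoint_one [simp]: "(1\<^sub>m n)\<^sup>\<dagger> = (1\<^sub>m n :: complex mat)"
  by (rule eq_matI) auto

lemma adjoint_mult:
  fixes M :: "complex mat"
  shows "dim_col M = dim_row N \<Longrightarrow> (M * N)\<^sup>\<dagger> = N\<^sup>\<dagger> * M\<^sup>\<dagger>"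
  by (rule eq_matI) (auto simp: scalar_prod_def mult.commute intro!: sum.cong)

lemmas adjoint_ring = adjoint_add adjoint_minus adjoint_smult adjoint_mult

lemma invertible_mat_iff_det:
  fixes M :: "'a :: field mat"
  assumes M: "M \<in> carrier_mat k k"
  shows "invertible_mat M \<longleftrightarrow> det M \<noteq> 0"
proof
  assume "invertible_mat M"
  then obtain N where N: "inverts_mat M N" "inverts_mat N M" by (auto simp: invertible_mat_def)
  then have MN: "M * N = 1\<^sub>m k" and NM: "N * M = 1\<^sub>m (dim_row N)" using M by (auto simp: inverts_mat_def)
  from MN have "dim_col N = k" by (metis index_mult_mat(3) index_one_mat(3))
  moreover from NM have "dim_row N = k" using M by (metis carrier_matD(2) index_mult_mat(3) index_one_mat(3))
  ultimately have "N \<in> carrier_mat k k" by auto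
  with MN M have "det M * det N = 1" by (metis det_mult det_one)
  then show "det M \<noteq> 0" by auto
next
  assume "det M \<noteq> 0"
  from det_non_zero_imp_unit[OF M this, of "()"] obtain N where
    "N \<in> carrier_mat k k" "N * M = 1\<^sub>m k" "M * N = 1\<^sub>m k"
    unfolding Units_def ring_mat_def by auto
  with M show "invertible_mat M" by (auto simp: invertible_mat_def inverts_mat_def)
qed

lemma mat_inv:
  assumes M: "M \<in> carrier_mat k k" and inv: "invertible_mat M"
  shows "mat_inv M \<in> carrier_mat k k" "M * mat_inv M = 1\<^sub>m k" "mat_inv M * M = 1\<^sub>m k"
proof -
  have "det M \<noteq> 0" using inv invertible_mat_iff_det[OF M] by simp
  from det_non_zero_imp_unit[OF M this, of "()"] obtain N where N: "mat_inverse M = Some N"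
    using mat_inverse(1)[OF M, where b = "()"] by (cases "mat_inverse M") auto
  from mat_inverse(2)[OF M N] N
  show "mat_inv M \<in> carrier_mat k k" "M * mat_inv M = 1\<^sub>m k" "mat_inv M * M = 1\<^sub>m k"
    by (auto simp: mat_inv_def)
qed

lemma mat_inv_unique:
  assumes M: "M \<in> carrier_mat k k" and N: "N \<in> carrier_mat k k" and MN: "M * N = 1\<^sub>m k"
  shows "invertible_mat M" "mat_inv M = N"
proof -
  have NM: "N * M = 1\<^sub>m k" using mat_mult_left_right_inverse[OF M N MN] .
  show inv: "invertible_mat M" using M N MN NM by (auto simp: invertible_mat_def inverts_mat_def)
  note I = mat_inv[OF M inv]
  have "mat_inv M = mat_inv M * (M * N)" using I MN by simp
  also have "\<dots> = (mat_inv M * M) * N" using assoc_mult_mat[OF I(1) M N] by simp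
  also have "\<dots> = N" using I N by simp
  finally show "mat_inv M = N" .
qed

lemma adjoint_mat_inv:
  assumes M: "M \<in> carrier_mat k k" and inv: "invertible_mat M"
  shows "invertible_mat (M\<^sup>\<dagger>)" "(mat_inv M)\<^sup>\<dagger> = mat_inv (M\<^sup>\<dagger>)"
proof -
  note I = mat_inv[OF M inv]
  have "M\<^sup>\<dagger> * (mat_inv M)\<^sup>\<dagger> = (mat_inv M * M)\<^sup>\<dagger>" using M I(1) by (simp add: adjoint_mult)
  also have "\<dots> = 1\<^sub>m k" using I by simp
  finally have e: "M\<^sup>\<dagger> * (mat_inv M)\<^sup>\<dagger> = 1\<^sub>m k" .
  show "invertible_mat (M\<^sup>\<dagger>)" "(mat_inv M)\<^sup>\<dagger> = mat_inv (M\<^sup>\<dagger>)"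
    using mat_inv_unique[OF adjoint_carrier[OF M] adjoint_carrier[OF I(1)] e] by simp_all
qed

text \<open>
  A kernel vector \<open>v\<close> would make \<open>\<langle>Mv, v\<rangle>\<close> vanish.
\<close>
lemma pos_def_mat_invertible:
  assumes M: "M \<in> carrier_mat k k" and pd: "pos_def_mat M"
  shows "invertible_mat M"
proof (rule ccontr)
  assume "\<not> invertible_mat M"
  then obtain v where v: "v \<in> carrier_vec k" "v \<noteq> 0\<^sub>v k" "M *\<^sub>v v = 0\<^sub>v k"
    using det_0_iff_vec_prod_zero_field[OF M] invertible_mat_iff_det[OF M] by auto
  have "Re ((M *\<^sub>v v) \<bullet>c v) > 0" using pd M v(1,2) by (simp add: pos_def_mat_def)
  with v show False by simp
qed

text \<open>
  A kernel vector of \<open>1 - zM\<close> is an eigenvector of \<open>M\<close> for \<open>1/z\<close>, which lies outside the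
  open unit disc.
\<close>
lemma stable_mat_invertible:
  assumes M: "M \<in> carrier_mat k k" and st: "stable_mat M" and z: "cmod z \<le> 1"
  shows "invertible_mat (1\<^sub>m k - z \<cdot>\<^sub>m M)"
proof (rule ccontr)
  let ?N = "1\<^sub>m k - z \<cdot>\<^sub>m M"
  have N: "?N \<in> carrier_mat k k" using M by auto
  assume "\<not> invertible_mat ?N"
  then obtain v where v: "v \<in> carrier_vec k" "v \<noteq> 0\<^sub>v k" "?N *\<^sub>v v = 0\<^sub>v k"
    using det_0_iff_vec_prod_zero_field[OF N] invertible_mat_iff_det[OF N] by auto
  have "?N *\<^sub>v v = v - z \<cdot>\<^sub>v (M *\<^sub>v v)"
    using M v by (subst minus_mult_distrib_mat_vec[of _ k k]) auto
  with v(3) have "v - z \<cdot>\<^sub>v (M *\<^sub>v v) = 0\<^sub>v k" by simp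
  then have e: "v $ i = z * (M *\<^sub>v v) $ i" if "i < k" for i
    using that M v by (auto simp: vec_eq_iff)
  have z0: "z \<noteq> 0" using e v by (auto simp: vec_eq_iff)
  have "M *\<^sub>v v = (1 / z) \<cdot>\<^sub>v v" using e z0 M v(1) by (intro eq_vecI) auto
  then have "eigenvalue M (1 / z)" using v M by (auto simp: eigenvalue_def eigenvector_def)
  then have "cmod (1 / z) < 1" using st by (auto simp: stable_mat_def)
  with z z0 show False by (simp add: norm_divide divide_simps)
qed

section \<open>Stein equations\<close>

text \<open>
  In a basis in which \<open>A\<close> is upper triangular (Schur), the \<open>(i, j)\<close> entry of the equation
  involves only entries \<open>(h, l)\<close> of the unknown with \<open>h \<le> i\<close> and \<open>l \<le> j\<close>. By induction on
  \<open>i + j\<close> it reduces to \<open>y = cnj a\<^sub>i * a\<^sub>j * y\<close> for eigenvalues \<open>a\<^sub>i, a\<^sub>j\<close> of \<open>A\<close>, whose product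
  has modulus less than \<open>1\<close>.
\<close>
lemma stein_equation_homogeneous:
  assumes A: "A \<in> carrier_mat k k" and st: "stable_mat A" and X: "X \<in> carrier_mat k k"
    and eq: "A\<^sup>\<dagger> * X * A = X"
  shows "X = 0\<^sub>m k k"
proof -
  obtain es where es: "char_poly A = (\<Prod>a\<leftarrow>es. [:- a, 1:])" using char_poly_factorized[OF A] by auto
  obtain T P P' where "schur_decomposition A es = (T, P, P')" by (metis prod_cases3)
  from schur_decomposition[OF A es this] have sim: "similar_mat_wit A T P P'"
    and ut: "upper_triangular T" and diag: "diag_mat T = es" by auto
  note S = similar_mat_witD2[OF A sim]
  have lt: "cmod (T $$ (i,i)) < 1" if "i < k" for i
  proof -
    have "T $$ (i,i) \<in> set es" using that S(5) by (auto simp: diag[symmetric] diag_mat_def)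
    then have "poly (char_poly A) (T $$ (i,i)) = 0"
      unfolding es poly_prod_list by (auto simp: prod_list_zero_iff)
    then show ?thesis using st eigenvalue_root_char_poly[OF A] by (auto simp: stable_mat_def)
  qed
  define Y where "Y = P\<^sup>\<dagger> * X * P"
  have Yc: "Y \<in> carrier_mat k k" unfolding Y_def using S X by (intro mult_carrier_mat[of _ k k]) auto
  note dims = carrier_matD[OF A] carrier_matD[OF X] carrier_matD[OF S(5)] carrier_matD[OF S(6)]
    carrier_matD[OF S(7)] carrier_matD[OF Yc]
  have AP: "A * P = P * T"
  proof -
    have "A * P = P * T * P' * P" using S(3) by simp
    also have "\<dots> = P * T * (P' * P)" by (simp add: dims assoc_mult_mat_dim)
    finally show ?thesis using S(2) by (simp add: dims right_mult_one_mat_dim)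
  qed
  have YT: "T\<^sup>\<dagger> * Y * T = Y"
  proof -
    have "T\<^sup>\<dagger> * Y * T = (P * T)\<^sup>\<dagger> * X * (P * T)"
      by (simp add: Y_def dims adjoint_mult assoc_mult_mat_dim)
    also have "\<dots> = P\<^sup>\<dagger> * (A\<^sup>\<dagger> * X * A) * P"
      unfolding AP[symmetric] by (simp add: dims adjoint_mult assoc_mult_mat_dim)
    finally show ?thesis unfolding eq Y_def .
  qed
  have Y0: "Y $$ (i,j) = 0" if "i < k" "j < k" for i j
    using that
  proof (induction "i + j" arbitrary: i j rule: less_induct)
    case less
    have "Y $$ (i,j) = (T\<^sup>\<dagger> * Y * T) $$ (i,j)" by (simp add: YT)
    also have "\<dots> = (\<Sum>l<k. (\<Sum>h<k. cnj (T $$ (h,i)) * Y $$ (h,l)) * T $$ (l,j))"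
      using less.prems by (simp add: dims scalar_prod_def atLeast0LessThan)
    also have "\<dots> = (\<Sum>l<k. \<Sum>h<k. if h = i \<and> l = j then cnj (T $$ (i,i)) * Y $$ (i,j) * T $$ (j,j) else 0)"
      unfolding sum_distrib_right
    proof (intro sum.cong refl)
      fix l h assume lh: "l \<in> {..<k}" "h \<in> {..<k}"
      \<comment> \<open>The term vanishes in the first two cases by triangularity, in the last one by induction.\<close>
      consider "h > i" | "l > j" | "h = i" "l = j" | "h + l < i + j" by linarith
      then show "cnj (T $$ (h,i)) * Y $$ (h,l) * T $$ (l,j) =
        (if h = i \<and> l = j then cnj (T $$ (i,i)) * Y $$ (i,j) * T $$ (j,j) else 0)"
      proof cases
        case 1 then have "T $$ (h,i) = 0" using ut lh by (auto simp: upper_triangular_def dims)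
        with 1 show ?thesis by simp
      next
        case 2 then have "T $$ (l,j) = 0" using ut lh by (auto simp: upper_triangular_def dims)
        with 2 show ?thesis by simp
      next
        case 4 then have "Y $$ (h,l) = 0" using less.hyps lh by auto
        with 4 show ?thesis by auto
      qed simp
    qed
    also have "\<dots> = (\<Sum>l<k. if l = j then cnj (T $$ (i,i)) * Y $$ (i,j) * T $$ (j,j) else 0)"
      using less.prems by (intro sum.cong refl) (auto simp: sum.delta)
    also have "\<dots> = cnj (T $$ (i,i)) * Y $$ (i,j) * T $$ (j,j)" using less.prems by simp
    finally have e: "Y $$ (i,j) = cnj (T $$ (i,i)) * T $$ (j,j) * Y $$ (i,j)" by (simp add: ac_simps)
    have "cmod (cnj (T $$ (i,i)) * T $$ (j,j)) < 1"
      using lt[OF less.prems(1)] lt[OF less.prems(2)]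
      by (metis complex_mod_cnj mult_strict_mono' norm_ge_zero norm_mult mult_1)
    then have "cnj (T $$ (i,i)) * T $$ (j,j) \<noteq> 1" by auto
    with e show ?case by (metis mult_cancel_right1 mult.commute)
  qed
  have "X = (P * P')\<^sup>\<dagger> * X * (P * P')" by (simp add: S(1) dims left_mult_one_mat_dim right_mult_one_mat_dim)
  also have "\<dots> = P'\<^sup>\<dagger> * Y * P'" by (simp add: Y_def dims adjoint_mult assoc_mult_mat_dim)
  also have "Y = 0\<^sub>m k k" using Y0 by (intro eq_matI) (auto simp: dims)
  also have "P'\<^sup>\<dagger> * 0\<^sub>m k k * P' = 0\<^sub>m k k"
    by (simp only: right_mult_zero_mat[OF adjoint_carrier[OF S(7)]] left_mult_zero_mat[OF S(7)])
  finally show ?thesis .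
qed

text \<open>
  The difference of \<open>X\<^sup>\<dagger>\<close> and \<open>X\<close> solves the homogeneous equation.
\<close>
lemma stein_equation_hermitian:
  assumes A: "A \<in> carrier_mat k k" and st: "stable_mat A" and X: "X \<in> carrier_mat k k"
    and W: "W \<in> carrier_mat k k" "W\<^sup>\<dagger> = W" and eq: "X - A\<^sup>\<dagger> * X * A = W"
  shows "X\<^sup>\<dagger> = X"
proof -
  note dims = carrier_matD[OF A] carrier_matD[OF X] carrier_matD[OF W(1)]
  let ?Y = "X\<^sup>\<dagger> - X"
  have "X\<^sup>\<dagger> - A\<^sup>\<dagger> * X\<^sup>\<dagger> * A = (X - A\<^sup>\<dagger> * X * A)\<^sup>\<dagger>"
    by (simp add: dims adjoint_ring assoc_mult_mat_dim)
  also have "\<dots> = X - A\<^sup>\<dagger> * X * A" using eq W by simp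
  finally have e: "X\<^sup>\<dagger> - A\<^sup>\<dagger> * X\<^sup>\<dagger> * A = X - A\<^sup>\<dagger> * X * A" .
  have "A\<^sup>\<dagger> * ?Y * A = A\<^sup>\<dagger> * X\<^sup>\<dagger> * A - A\<^sup>\<dagger> * X * A"
    by (simp add: dims minus_mult_distrib_mat_dim mult_minus_distrib_mat_dim)
  also have "\<dots> = ?Y"
  proof (rule eq_matI)
    fix i j assume ij: "i < dim_row ?Y" "j < dim_col ?Y"
    have "(X\<^sup>\<dagger> - A\<^sup>\<dagger> * X\<^sup>\<dagger> * A) $$ (i,j) = (X - A\<^sup>\<dagger> * X * A) $$ (i,j)" using e by simp
    with ij show "(A\<^sup>\<dagger> * X\<^sup>\<dagger> * A - A\<^sup>\<dagger> * X * A) $$ (i,j) = ?Y $$ (i,j)"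
      by (simp add: dims algebra_simps del: index_mult_mat(1))
  qed (auto simp: dims)
  finally have "?Y = 0\<^sub>m k k"
    using stein_equation_homogeneous[OF A st, of ?Y] X by (auto simp: minus_carrier_mat)
  then have "X\<^sup>\<dagger> = 0\<^sub>m k k + X" by (subst (asm) diff_eq_iff_mat_dim) (auto simp: dims)
  then show ?thesis using X by simp
qed

section \<open>Resolvents\<close>

text \<open>
  Working with \<open>(z - F)\<^bsup>-1\<^esup>\<close> at \<open>z\<close> and at \<open>1/z\<close>, in place of \<open>(1 - zF)\<^bsup>-1\<^esup>\<close>, makes the causal and the
  anticausal part of \<open>R\<close> look alike: \<open>z (1 - zF)\<^bsup>-1\<^esup>\<close> is the resolvent at \<open>1/z\<close>, and the adjoint
  of the resolvent of \<open>F\<close> at \<open>z\<close> is the resolvent of \<open>F\<^sup>\<dagger>\<close> at \<open>cnj z\<close>.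
\<close>
definition resolvent :: "complex \<Rightarrow> complex mat \<Rightarrow> complex mat" where
  "resolvent z F = mat_inv (z \<cdot>\<^sub>m 1\<^sub>m (dim_row F) - F)"

definition resolvent_point :: "complex \<Rightarrow> complex mat \<Rightarrow> bool" where
  "resolvent_point z F \<longleftrightarrow> square_mat F \<and> invertible_mat (z \<cdot>\<^sub>m 1\<^sub>m (dim_row F) - F)"

lemma resolvent_dims [simp]:
  assumes "resolvent_point z F"
  shows "dim_row (resolvent z F) = dim_row F" "dim_col (resolvent z F) = dim_row F" "dim_col F = dim_row F"
proof -
  have F: "z \<cdot>\<^sub>m 1\<^sub>m (dim_row F) - F \<in> carrier_mat (dim_row F) (dim_row F)"
    using assms by (intro carrier_matI) (auto simp: resolvent_point_def)
  from mat_inv(1)[OF this] assms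
  show "dim_row (resolvent z F) = dim_row F" "dim_col (resolvent z F) = dim_row F" "dim_col F = dim_row F"
    unfolding resolvent_def resolvent_point_def by auto
qed

text \<open>
  These two equations, free of subtraction, replace the inverse: with them, products that
  contain a resolvent are computed by distributivity and cancellation.
\<close>
lemma resolvent_eq:
  assumes "resolvent_point z F"
  shows "z \<cdot>\<^sub>m resolvent z F = 1\<^sub>m (dim_row F) + F * resolvent z F"
    and "z \<cdot>\<^sub>m resolvent z F = 1\<^sub>m (dim_row F) + resolvent z F * F"
proof -
  let ?r = "resolvent z F" and ?k = "dim_row F"
  note d = resolvent_dims[OF assms]
  have F: "z \<cdot>\<^sub>m 1\<^sub>m ?k - F \<in> carrier_mat ?k ?k"
    using d by (intro carrier_matI) auto
  note I = mat_inv(2,3)[OF F, folded resolvent_def]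
  have inv: "invertible_mat (z \<cdot>\<^sub>m 1\<^sub>m ?k - F)" using assms by (simp add: resolvent_point_def)
  have "z \<cdot>\<^sub>m ?r - F * ?r = 1\<^sub>m ?k"
    using I(1)[OF inv] d
    by (simp add: minus_mult_distrib_mat_dim smult_mult_mat_dim left_mult_one_mat_dim)
  then show "z \<cdot>\<^sub>m ?r = 1\<^sub>m ?k + F * ?r" using d by (subst (asm) diff_eq_iff_mat_dim) auto
  have "z \<cdot>\<^sub>m ?r - ?r * F = 1\<^sub>m ?k"
    using I(2)[OF inv] d
    by (simp add: mult_minus_distrib_mat_dim mult_smult_mat_dim right_mult_one_mat_dim)
  then show "z \<cdot>\<^sub>m ?r = 1\<^sub>m ?k + ?r * F" using d by (subst (asm) diff_eq_iff_mat_dim) auto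
qed

lemma resolvent_unique:
  assumes rp: "resolvent_point z F" and d: "dim_row X = dim_row F" "dim_row Y = dim_row F" "dim_col Y = dim_col X"
    and eq: "z \<cdot>\<^sub>m X = F * X + Y"
  shows "X = resolvent z F * Y"
proof -
  let ?r = "resolvent z F"
  note rd = resolvent_dims[OF rp]
  have "X + ?r * (F * X) = (z \<cdot>\<^sub>m ?r) * X"
    using rd d by (simp add: resolvent_eq(2)[OF rp] mat_ring)
  also have "\<dots> = ?r * (z \<cdot>\<^sub>m X)" using rd d by (simp add: mat_ring)
  also have "\<dots> = ?r * Y + ?r * (F * X)" unfolding eq using rd d by (simp add: mat_ring)
  finally show ?thesis by (rule add_right_cancel_mat_dim) (use rd d in auto)
qed

lemma resolvent_adjoint:
  assumes "resolvent_point z F"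
  shows "resolvent_point (cnj z) (F\<^sup>\<dagger>)" "(resolvent z F)\<^sup>\<dagger> = resolvent (cnj z) (F\<^sup>\<dagger>)"
proof -
  note d = resolvent_dims[OF assms]
  have F: "z \<cdot>\<^sub>m 1\<^sub>m (dim_row F) - F \<in> carrier_mat (dim_row F) (dim_row F)"
    using d by (intro carrier_matI) auto
  have e: "(z \<cdot>\<^sub>m 1\<^sub>m (dim_row F) - F)\<^sup>\<dagger> = cnj z \<cdot>\<^sub>m 1\<^sub>m (dim_row F) - F\<^sup>\<dagger>"
    using d by (simp add: adjoint_ring)
  show "resolvent_point (cnj z) (F\<^sup>\<dagger>)" "(resolvent z F)\<^sup>\<dagger> = resolvent (cnj z) (F\<^sup>\<dagger>)"
    using adjoint_mat_inv[OF F] assms d unfolding e resolvent_def resolvent_point_def by auto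
qed

text \<open>
  This is the reason why Stein and Riccati equations produce factorizations: the product of a
  resolvent in \<open>z\<close> and one in \<open>1/z\<close> splits into a sum if what stands between them is a defect
  \<open>X - FXG\<close>. Indeed, as \<open>zu = 1\<close>, the product \<open>r X s\<close> equals \<open>(zr) X (us)\<close>, and expanding
  \<open>zr = 1 + rF\<close> and \<open>us = 1 + Gs\<close> leaves \<open>X + rFX + XGs + rFXGs\<close>,
  while on the other side \<open>r X s = r W s + rFXGs\<close>.
\<close>
lemma resolvent_product:
  assumes F: "resolvent_point z F" and G: "resolvent_point u G" and zu: "z * u = 1"
    and d: "dim_row X = dim_row F" "dim_col X = dim_row G" "dim_row W = dim_row F" "dim_col W = dim_row G"
    and eq: "X = W + F * X * G"
  shows "resolvent z F * W * resolvent u G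
    = X + resolvent z F * F * X + X * G * resolvent u G"
proof -
  let ?r = "resolvent z F" and ?s = "resolvent u G"
  note rd = resolvent_dims[OF F] resolvent_dims[OF G]
  have "?r * W * ?s + ?r * F * X * G * ?s = ?r * (W + F * X * G) * ?s"
    using rd d by (simp add: mat_ring)
  also have "\<dots> = (z * u) \<cdot>\<^sub>m (?r * X * ?s)" using zu unfolding eq[symmetric] by (simp add: one_smult_mat)
  also have "\<dots> = (z \<cdot>\<^sub>m ?r) * X * (u \<cdot>\<^sub>m ?s)"
    using rd d by (simp add: mat_ring mult.commute)
  also have "\<dots> = (X + ?r * F * X + X * G * ?s) + ?r * F * X * G * ?s"
    unfolding resolvent_eq(2)[OF F] resolvent_eq(1)[OF G] using rd d by (simp add: mat_ring)
  finally show ?thesis by (rule add_right_cancel_mat_dim) (use rd d in auto)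
qed

text \<open>
  The left factor is a function of \<open>z\<close>, the right one of \<open>u = 1/z\<close>. If \<open>X\<close> solves the
  Stein-type equation with right-hand side \<open>K L\<close>, their product has no mixed term: it is a
  constant plus a realization in \<open>z\<close> plus one in \<open>1/z\<close>.
\<close>
lemma para_factor_product:
  assumes F: "resolvent_point z F" and G: "resolvent_point u G" and zu: "z * u = 1"
    and d: "dim_row X = dim_row F" "dim_col X = dim_row G"
      "dim_row K = dim_row F" "dim_row L = dim_col K" "dim_col L = dim_row G"
      "dim_col H = dim_row F" "dim_row M = dim_row G"
      "dim_row I = dim_row H" "dim_col I = dim_col K" "dim_row J = dim_row L" "dim_col J = dim_col M"
    and eq: "X = K * L + F * X * G"
  shows "(I + H * resolvent z F * K) * (J + L * resolvent u G * M)
    = (I * J + H * X * M) + H * resolvent z F * (K * J + F * X * M)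
      + (I * L + H * X * G) * resolvent u G * M"
proof -
  let ?r = "resolvent z F" and ?s = "resolvent u G"
  note rd = resolvent_dims[OF F] resolvent_dims[OF G]
  have "H * (?r * (K * L) * ?s) * M = H * (X + ?r * F * X + X * G * ?s) * M"
    using resolvent_product[OF F G zu _ _ _ _ eq] d by simp
  then have e: "H * (?r * (K * (L * (?s * M)))) = H * (X * M) + (H * (?r * (F * (X * M))) + H * (X * (G * (?s * M))))"
    using rd d by (simp add: mat_ring)
  show ?thesis using rd d by (simp add: mat_ring e)
qed

lemma resolvent_inverse_point:
  assumes M: "M \<in> carrier_mat k k" and z: "z \<noteq> 0"
  shows "resolvent_point (1 / z) M \<longleftrightarrow> invertible_mat (1\<^sub>m k - z \<cdot>\<^sub>m M)"
    and "invertible_mat (1\<^sub>m k - z \<cdot>\<^sub>m M) \<Longrightarrow> z \<cdot>\<^sub>m mat_inv (1\<^sub>m k - z \<cdot>\<^sub>m M) = resolvent (1 / z) M"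
proof -
  let ?N = "1\<^sub>m k - z \<cdot>\<^sub>m M" and ?S = "(1 / z) \<cdot>\<^sub>m 1\<^sub>m k - M"
  have N: "?N \<in> carrier_mat k k" and S: "?S \<in> carrier_mat k k" using M by auto
  have NS: "?N = z \<cdot>\<^sub>m ?S" using z M by (intro eq_matI) (auto simp: field_simps)
  have "det ?N = z ^ k * det ?S" unfolding NS using S M by simp
  then have iff: "invertible_mat ?N \<longleftrightarrow> invertible_mat ?S"
    using z invertible_mat_iff_det[OF N] invertible_mat_iff_det[OF S] by simp
  with M show "resolvent_point (1 / z) M \<longleftrightarrow> invertible_mat ?N" by (auto simp: resolvent_point_def)
  assume inv: "invertible_mat ?N"
  note I = mat_inv[OF N inv]
  have "?S * (z \<cdot>\<^sub>m mat_inv ?N) = ?N * mat_inv ?N"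
    unfolding NS using carrier_matD[OF I(1)[unfolded NS]] carrier_matD[OF S]
    by (simp add: smult_mult_mat_dim mult_smult_mat_dim del: index_minus_mat)
  also have "\<dots> = 1\<^sub>m k" using I by simp
  finally have "mat_inv ?S = z \<cdot>\<^sub>m mat_inv ?N"
    using I(1) by (intro mat_inv_unique(2)[OF S]) auto
  then show "z \<cdot>\<^sub>m mat_inv ?N = resolvent (1 / z) M"
    using M by (simp add: resolvent_def)
qed

section \<open>Block triangular resolvents\<close>

lemma hstack_mult_append_rows:
  assumes "X \<in> carrier_mat a n" "Y \<in> carrier_mat a p" "U \<in> carrier_mat n b" "V \<in> carrier_mat p b"
  shows "hstack X Y * (U @\<^sub>r V) = X * U + Y * V"
proof -
  note d = carrier_matD[OF assms(1)] carrier_matD[OF assms(2)] carrier_matD[OF assms(3)] carrier_matD[OF assms(4)]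
  have "hstack X Y * (U @\<^sub>r V) = four_block_mat (X * U + Y * V) (X * 0\<^sub>m n 0 + Y * 0\<^sub>m p 0)
      (0\<^sub>m 0 n * U + 0\<^sub>m 0 p * V) (0\<^sub>m 0 n * 0\<^sub>m n 0 + 0\<^sub>m 0 p * 0\<^sub>m p 0)"
    unfolding hstack_def append_rows_def d by (rule mult_four_block_mat) (use assms in auto)
  also have "\<dots> = X * U + Y * V" by (rule eq_matI) (auto simp: d)
  finally show ?thesis .
qed

lemma four_block_mult_append_rows:
  assumes "F \<in> carrier_mat a n" "E \<in> carrier_mat a p" "H \<in> carrier_mat c n" "G \<in> carrier_mat c p"
    "U \<in> carrier_mat n b" "V \<in> carrier_mat p b"
  shows "four_block_mat F E H G * (U @\<^sub>r V) = (F * U + E * V) @\<^sub>r (H * U + G * V)"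
proof -
  note d = carrier_matD[OF assms(1)] carrier_matD[OF assms(2)] carrier_matD[OF assms(3)] carrier_matD[OF assms(4)]
    carrier_matD[OF assms(5)] carrier_matD[OF assms(6)]
  have "four_block_mat F E H G * (U @\<^sub>r V) = four_block_mat (F * U + E * V) (F * 0\<^sub>m n 0 + E * 0\<^sub>m p 0)
      (H * U + G * V) (H * 0\<^sub>m n 0 + G * 0\<^sub>m p 0)"
    unfolding append_rows_def d by (rule mult_four_block_mat) (use assms in auto)
  also have "\<dots> = (F * U + E * V) @\<^sub>r (H * U + G * V)"
    unfolding append_rows_def by (rule eq_matI) (auto simp: d)
  finally show ?thesis .
qed

lemma append_rows_dims [simp]:
  "dim_row (U @\<^sub>r V) = dim_row U + dim_row V" "dim_col (U @\<^sub>r V) = dim_col U"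
  by (simp_all add: append_rows_def)

lemma hstack_dims [simp]:
  "dim_row (hstack X Y) = dim_row X" "dim_col (hstack X Y) = dim_col X + dim_col Y"
  by (simp_all add: hstack_def)

text \<open>
  The vector \<open>(U', V')\<close> with \<open>V' = (z - G)\<^bsup>-1\<^esup> V\<close> and \<open>U' = (z - F)\<^bsup>-1\<^esup> (U + E V')\<close> solves
  the block triangular system by back substitution.
\<close>
lemma resolvent_block_upper:
  assumes F: "resolvent_point z F" "F \<in> carrier_mat n n" and G: "resolvent_point z G" "G \<in> carrier_mat p p"
    and c: "E \<in> carrier_mat n p" "X \<in> carrier_mat a n" "Y \<in> carrier_mat a p"
    "U \<in> carrier_mat n b" "V \<in> carrier_mat p b"
  defines "T \<equiv> four_block_mat F E (0\<^sub>m p n) G"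
  shows "resolvent_point z T"
    and "hstack X Y * resolvent z T * (U @\<^sub>r V)
      = X * resolvent z F * (U + E * resolvent z G * V) + Y * resolvent z G * V"
proof -
  note d = carrier_matD[OF F(2)] carrier_matD[OF G(2)] carrier_matD[OF c(1)] carrier_matD[OF c(2)]
    carrier_matD[OF c(3)] carrier_matD[OF c(4)] carrier_matD[OF c(5)]
  have T: "T \<in> carrier_mat (n + p) (n + p)" using F G by (auto simp: T_def)
  let ?S = "z \<cdot>\<^sub>m 1\<^sub>m (n + p) - T"
  have "?S = four_block_mat (z \<cdot>\<^sub>m 1\<^sub>m n - F) (- E) (0\<^sub>m p n) (z \<cdot>\<^sub>m 1\<^sub>m p - G)"
    by (rule eq_matI) (auto simp: d T_def)
  then have "det ?S = det (z \<cdot>\<^sub>m 1\<^sub>m n - F) * det (z \<cdot>\<^sub>m 1\<^sub>m p - G)"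
    using det_four_block_mat_lower_left_zero[of "z \<cdot>\<^sub>m 1\<^sub>m n - F" n "- E" p "0\<^sub>m p n" "z \<cdot>\<^sub>m 1\<^sub>m p - G"] F G c
    by (simp add: minus_carrier_mat)
  also have "\<dots> \<noteq> 0"
    using F G invertible_mat_iff_det[of "z \<cdot>\<^sub>m 1\<^sub>m n - F" n] invertible_mat_iff_det[of "z \<cdot>\<^sub>m 1\<^sub>m p - G" p] d
    by (simp add: resolvent_point_def minus_carrier_mat)
  finally show rT: "resolvent_point z T"
    using T invertible_mat_iff_det[of ?S "n + p"] by (simp add: resolvent_point_def minus_carrier_mat)
  note rd = resolvent_dims[OF F(1)] resolvent_dims[OF G(1)] resolvent_dims[OF rT] carrier_matD[OF T]
  define V' where "V' = resolvent z G * V"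
  define U' where "U' = resolvent z F * (U + E * V')"
  have V': "V' \<in> carrier_mat p b" and U': "U' \<in> carrier_mat n b"
    unfolding V'_def U'_def by (auto simp: d rd intro!: carrier_matI)
  note d' = carrier_matD[OF V'] carrier_matD[OF U']
  have zV: "z \<cdot>\<^sub>m V' = V + G * V'"
  proof -
    have "z \<cdot>\<^sub>m V' = (z \<cdot>\<^sub>m resolvent z G) * V" by (simp add: V'_def rd d mat_ring)
    also have "\<dots> = V + G * V'" unfolding resolvent_eq(1)[OF G(1)] by (simp add: V'_def rd d mat_ring)
    finally show ?thesis .
  qed
  have zU: "z \<cdot>\<^sub>m U' = (U + E * V') + F * U'"
  proof -
    have "z \<cdot>\<^sub>m U' = (z \<cdot>\<^sub>m resolvent z F) * (U + E * V')" by (simp add: U'_def rd d d' mat_ring)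
    also have "\<dots> = (U + E * V') + F * U'" unfolding resolvent_eq(1)[OF F(1)] by (simp add: U'_def rd d d' mat_ring)
    finally show ?thesis .
  qed
  have "z \<cdot>\<^sub>m (U' @\<^sub>r V') = (z \<cdot>\<^sub>m U') @\<^sub>r (z \<cdot>\<^sub>m V')"
    unfolding append_rows_def by (rule eq_matI) (auto simp: d')
  also have "\<dots> = (F * U' + E * V' + U) @\<^sub>r (0\<^sub>m p n * U' + G * V' + V)"
    unfolding zU zV using V' U' by (simp add: rd d d' mat_ring add_zero_mat_dim)
  also have "\<dots> = ((F * U' + E * V') @\<^sub>r (0\<^sub>m p n * U' + G * V')) + (U @\<^sub>r V)"
    unfolding append_rows_def by (rule eq_matI) (auto simp: d d')
  also have "\<dots> = T * (U' @\<^sub>r V') + (U @\<^sub>r V)"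
    unfolding T_def by (subst four_block_mult_append_rows) (use F G c U' V' in auto)
  finally have "U' @\<^sub>r V' = resolvent z T * (U @\<^sub>r V)"
    by (intro resolvent_unique[OF rT]) (auto simp: rd d d')
  then have "hstack X Y * resolvent z T * (U @\<^sub>r V) = hstack X Y * (U' @\<^sub>r V')"
    using rd d by (simp add: assoc_mult_mat_dim)
  also have "\<dots> = X * U' + Y * V'" using hstack_mult_append_rows c U' V' by blast
  finally show "hstack X Y * resolvent z T * (U @\<^sub>r V)
      = X * resolvent z F * (U + E * resolvent z G * V) + Y * resolvent z G * V"
    using rd d by (simp add: U'_def V'_def assoc_mult_mat_dim)
qed

section \<open>Factorization identities\<close>

text \<open>
  With \<open>u = 1/z\<close> the left-hand side is \<open>R*(z) R(z)\<close> in resolvent form. In the product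
  of the causal parts the factor \<open>C\<^sup>\<dagger> C\<close>, and in that of the anticausal parts \<open>\<gamma>\<^sup>\<dagger> \<gamma>\<close>, is replaced by the defect of the
  Stein solution; both products then split. The two cross terms already are functions of one of
  \<open>z\<close>, \<open>1/z\<close> alone. On the right, the second summand is a realization in \<open>z\<close>,
  the third one in \<open>1/z\<close>.
\<close>
lemma two_sided_gram:
  assumes c: "R0 \<in> carrier_mat m m" "A \<in> carrier_mat n n" "B \<in> carrier_mat n m" "C \<in> carrier_mat m n"
    "\<alpha> \<in> carrier_mat p p" "\<beta> \<in> carrier_mat p m" "\<gamma> \<in> carrier_mat m p"
    "P \<in> carrier_mat n n" "P' \<in> carrier_mat p p"
    and P: "P = C\<^sup>\<dagger> * C + A\<^sup>\<dagger> * P * A"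
    and P': "P' = \<gamma>\<^sup>\<dagger> * \<gamma> + \<alpha>\<^sup>\<dagger> * P' * \<alpha>"
    and zu: "z * u = 1"
    and rp: "resolvent_point z (A\<^sup>\<dagger>)" "resolvent_point u A" "resolvent_point z \<alpha>" "resolvent_point u (\<alpha>\<^sup>\<dagger>)"
  shows "(R0\<^sup>\<dagger> + B\<^sup>\<dagger> * resolvent z (A\<^sup>\<dagger>) * C\<^sup>\<dagger> + \<beta>\<^sup>\<dagger> * resolvent u (\<alpha>\<^sup>\<dagger>) * \<gamma>\<^sup>\<dagger>)
      * (R0 + C * resolvent u A * B + \<gamma> * resolvent z \<alpha> * \<beta>)
    = (R0\<^sup>\<dagger> * R0 + B\<^sup>\<dagger> * P * B + \<beta>\<^sup>\<dagger> * P' * \<beta>)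
      + (B\<^sup>\<dagger> * resolvent z (A\<^sup>\<dagger>) * ((C\<^sup>\<dagger> * R0 + A\<^sup>\<dagger> * P * B) + C\<^sup>\<dagger> * \<gamma> * resolvent z \<alpha> * \<beta>)
          + (R0\<^sup>\<dagger> * \<gamma> + \<beta>\<^sup>\<dagger> * P' * \<alpha>) * resolvent z \<alpha> * \<beta>)
      + (((R0\<^sup>\<dagger> * C + B\<^sup>\<dagger> * P * A) + \<beta>\<^sup>\<dagger> * resolvent u (\<alpha>\<^sup>\<dagger>) * \<gamma>\<^sup>\<dagger> * C) * resolvent u A * B
          + \<beta>\<^sup>\<dagger> * resolvent u (\<alpha>\<^sup>\<dagger>) * (\<gamma>\<^sup>\<dagger> * R0 + \<alpha>\<^sup>\<dagger> * P' * \<beta>))"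
    (is "(?L1 + ?L2) * (?R1 + ?R2) = _")
proof -
  note d = c[THEN carrier_matD(1)] c[THEN carrier_matD(2)] resolvent_dims(1,2)[OF rp(1)]
    resolvent_dims(1,2)[OF rp(2)] resolvent_dims(1,2)[OF rp(3)] resolvent_dims(1,2)[OF rp(4)]
  have uz: "u * z = 1" using zu by (simp add: mult.commute)
  have 1: "?L1 * ?R1 = (R0\<^sup>\<dagger> * R0 + B\<^sup>\<dagger> * P * B)
      + B\<^sup>\<dagger> * resolvent z (A\<^sup>\<dagger>) * (C\<^sup>\<dagger> * R0 + A\<^sup>\<dagger> * P * B)
      + (R0\<^sup>\<dagger> * C + B\<^sup>\<dagger> * P * A) * resolvent u A * B"
    by (rule para_factor_product[OF rp(1,2) zu]) (simp_all add: d P[symmetric])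
  have 2: "?L2 * ?R2 = \<beta>\<^sup>\<dagger> * P' * \<beta> + \<beta>\<^sup>\<dagger> * resolvent u (\<alpha>\<^sup>\<dagger>) * (\<alpha>\<^sup>\<dagger> * P' * \<beta>)
      + \<beta>\<^sup>\<dagger> * P' * \<alpha> * resolvent z \<alpha> * \<beta>"
  proof -
    have "?L2 * ?R2 = \<beta>\<^sup>\<dagger> * (resolvent u (\<alpha>\<^sup>\<dagger>) * (\<gamma>\<^sup>\<dagger> * \<gamma>) * resolvent z \<alpha>) * \<beta>"
      by (simp add: d assoc_mult_mat_dim)
    also have "resolvent u (\<alpha>\<^sup>\<dagger>) * (\<gamma>\<^sup>\<dagger> * \<gamma>) * resolvent z \<alpha>
        = P' + resolvent u (\<alpha>\<^sup>\<dagger>) * \<alpha>\<^sup>\<dagger> * P' + P' * \<alpha> * resolvent z \<alpha>"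
      by (rule resolvent_product[OF rp(4,3) uz _ _ _ _ P']) (simp_all add: d)
    finally show ?thesis by (simp add: d mat_ring)
  qed
  have "(?L1 + ?L2) * (?R1 + ?R2) = ?L1 * ?R1 + ?L1 * ?R2 + ?L2 * ?R1 + ?L2 * ?R2"
    by (simp add: d add_mult_distrib_mat_dim mult_add_distrib_mat_dim add_assoc_mat_dim add_left_commute_mat_dim)
  also have "\<dots> = (R0\<^sup>\<dagger> * R0 + B\<^sup>\<dagger> * P * B + \<beta>\<^sup>\<dagger> * P' * \<beta>)
      + (B\<^sup>\<dagger> * resolvent z (A\<^sup>\<dagger>) * ((C\<^sup>\<dagger> * R0 + A\<^sup>\<dagger> * P * B) + C\<^sup>\<dagger> * \<gamma> * resolvent z \<alpha> * \<beta>)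
          + (R0\<^sup>\<dagger> * \<gamma> + \<beta>\<^sup>\<dagger> * P' * \<alpha>) * resolvent z \<alpha> * \<beta>)
      + (((R0\<^sup>\<dagger> * C + B\<^sup>\<dagger> * P * A) + \<beta>\<^sup>\<dagger> * resolvent u (\<alpha>\<^sup>\<dagger>) * \<gamma>\<^sup>\<dagger> * C) * resolvent u A * B
          + \<beta>\<^sup>\<dagger> * resolvent u (\<alpha>\<^sup>\<dagger>) * (\<gamma>\<^sup>\<dagger> * R0 + \<alpha>\<^sup>\<dagger> * P' * \<beta>))"
    unfolding 1 2 by (simp add: d mat_ring)
  finally show ?thesis .
qed

text \<open>
  Here \<open>E\<close> is the inverse of \<open>D\<close>. The Riccati equation says that \<open>L\<^sup>\<dagger> D\<^bsup>-2\<^esup> L\<close>, the constant between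
  the two resolvents, is the defect of \<open>Q\<close>. The definitions of \<open>D\<close> and \<open>L\<close> are those for
  which the terms with \<open>Q\<close> produced by the splitting cancel, so that only the data \<open>W\<close>, \<open>G\<close>, \<open>H\<close>
  remain.
\<close>
lemma riccati_factor_gram:
  assumes c: "F \<in> carrier_mat N N" "G \<in> carrier_mat N m" "H \<in> carrier_mat m N" "W \<in> carrier_mat m m"
    "Q \<in> carrier_mat N N" "D \<in> carrier_mat m m" "E \<in> carrier_mat m m" "L \<in> carrier_mat m N"
    and D2: "D * D = W - H * Q * H\<^sup>\<dagger>" and ED: "E * D = 1\<^sub>m m" and DE: "D * E = 1\<^sub>m m"
    and L: "L = G\<^sup>\<dagger> - H * Q * F\<^sup>\<dagger>" and L': "L\<^sup>\<dagger> = G - F * Q * H\<^sup>\<dagger>"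
    and ric: "Q - F * Q * F\<^sup>\<dagger> = L\<^sup>\<dagger> * (E * E) * L"
    and zu: "z * u = 1" and rp: "resolvent_point z F" "resolvent_point u (F\<^sup>\<dagger>)"
  shows "(D + H * resolvent z F * (L\<^sup>\<dagger> * E)) * (D + E * L * resolvent u (F\<^sup>\<dagger>) * H\<^sup>\<dagger>)
    = W + H * resolvent z F * G + G\<^sup>\<dagger> * resolvent u (F\<^sup>\<dagger>) * H\<^sup>\<dagger>"
proof -
  note d = c[THEN carrier_matD(1)] c[THEN carrier_matD(2)] resolvent_dims(1,2)[OF rp(1)]
    resolvent_dims(1,2)[OF rp(2)]
  have Q: "Q = (L\<^sup>\<dagger> * E) * (E * L) + F * Q * F\<^sup>\<dagger>"
  proof -
    have "Q = L\<^sup>\<dagger> * (E * E) * L + F * Q * F\<^sup>\<dagger>"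
      using ric by (subst (asm) diff_eq_iff_mat_dim) (simp_all add: d)
    then show ?thesis by (simp add: d assoc_mult_mat_dim)
  qed
  have "(D + H * resolvent z F * (L\<^sup>\<dagger> * E)) * (D + E * L * resolvent u (F\<^sup>\<dagger>) * H\<^sup>\<dagger>)
    = (D * D + H * Q * H\<^sup>\<dagger>) + H * resolvent z F * (L\<^sup>\<dagger> * E * D + F * Q * H\<^sup>\<dagger>)
      + (D * (E * L) + H * Q * F\<^sup>\<dagger>) * resolvent u (F\<^sup>\<dagger>) * H\<^sup>\<dagger>"
    by (rule para_factor_product[OF rp zu _ _ _ _ _ _ _ _ _ _ _ Q]) (simp_all add: d)
  also have "D * D + H * Q * H\<^sup>\<dagger> = W"
    using D2[symmetric] by (subst (asm) diff_eq_iff_mat_dim) (simp_all add: d)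
  also have "L\<^sup>\<dagger> * E * D = L\<^sup>\<dagger>" using ED by (simp add: d assoc_mult_mat_dim right_mult_one_mat_dim)
  also have "L\<^sup>\<dagger> + F * Q * H\<^sup>\<dagger> = G"
    using L'[symmetric] by (subst (asm) diff_eq_iff_mat_dim) (simp_all add: d)
  also have "D * (E * L) = L"
    using DE by (simp add: d assoc_mult_mat_dim[symmetric] left_mult_one_mat_dim)
  also have "L + H * Q * F\<^sup>\<dagger> = G\<^sup>\<dagger>"
    using L[symmetric] by (subst (asm) diff_eq_iff_mat_dim) (simp_all add: d)
  finally show ?thesis .
qed

section \<open>The inverse of a realization\<close>

text \<open>
  With \<open>r = (1 - zM)\<^bsup>-1\<^esup>\<close> and \<open>t = (1 - zM\<^sub>0)\<^bsup>-1\<^esup>\<close>, the resolvent identity for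
  \<open>M - M\<^sub>0 = H E\<^sup>2 L\<close> reads \<open>r = t + z t H E\<^sup>2 L r\<close>. Sandwiched between \<open>z E\<^sup>2 L\<close> and \<open>H\<close> it
  says that the asserted inverse is a left inverse, hence, the matrix being square, an inverse.
\<close>
lemma realization_inverse:
  assumes c: "D \<in> carrier_mat m m" "M \<in> carrier_mat N N" "H \<in> carrier_mat N m" "L \<in> carrier_mat m N"
    "E \<in> carrier_mat m m" and DE: "D * E = 1\<^sub>m m"
    and M0: "M0 = M - H * (E * E) * L"
    and inv: "invertible_mat (1\<^sub>m N - z \<cdot>\<^sub>m M)" "invertible_mat (1\<^sub>m N - z \<cdot>\<^sub>m M0)"
  shows "invertible_mat (D + z \<cdot>\<^sub>m (E * L * mat_inv (1\<^sub>m N - z \<cdot>\<^sub>m M) * H))"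
    and "mat_inv (D + z \<cdot>\<^sub>m (E * L * mat_inv (1\<^sub>m N - z \<cdot>\<^sub>m M) * H))
      = E - z \<cdot>\<^sub>m (E * E * L * mat_inv (1\<^sub>m N - z \<cdot>\<^sub>m M0) * H * E)"
proof -
  define r where "r = mat_inv (1\<^sub>m N - z \<cdot>\<^sub>m M)"
  define t where "t = mat_inv (1\<^sub>m N - z \<cdot>\<^sub>m M0)"
  let ?Psi = "D + z \<cdot>\<^sub>m (E * L * r * H)" and ?V = "E - z \<cdot>\<^sub>m (E * E * L * t * H * E)"
  have M0c: "M0 \<in> carrier_mat N N" unfolding M0 using c by (intro carrier_matI) auto
  have k: "1\<^sub>m N - z \<cdot>\<^sub>m M \<in> carrier_mat N N" "1\<^sub>m N - z \<cdot>\<^sub>m M0 \<in> carrier_mat N N"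
    using c M0c by (auto intro!: carrier_matI)
  note rI = mat_inv[OF k(1) inv(1), folded r_def] and tI = mat_inv[OF k(2) inv(2), folded t_def]
  note d = c[THEN carrier_matD(1)] c[THEN carrier_matD(2)] M0c[THEN carrier_matD(1)] M0c[THEN carrier_matD(2)]
    carrier_matD[OF rI(1)] carrier_matD[OF tI(1)]
  have ED: "E * D = 1\<^sub>m m" by (rule mat_mult_left_right_inverse[OF c(1,5) DE])
  have ED': "E * (D * Y) = Y" if "dim_row Y = m" for Y
    using ED that by (simp add: d assoc_mult_mat_dim[symmetric] left_mult_one_mat_dim)
  have M: "M = M0 + H * (E * E) * L"
    using M0[symmetric] by (subst (asm) diff_eq_iff_mat_dim) (simp_all add: d)
  have r1: "r = 1\<^sub>m N + z \<cdot>\<^sub>m (M * r)"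
    using rI(2) by (simp add: d minus_mult_distrib_mat_dim smult_mult_mat_dim left_mult_one_mat_dim)
      (subst (asm) diff_eq_iff_mat_dim, simp_all add: d)
  have t1: "t = 1\<^sub>m N + z \<cdot>\<^sub>m (t * M0)"
    using tI(3) by (simp add: d mult_minus_distrib_mat_dim mult_smult_mat_dim right_mult_one_mat_dim)
      (subst (asm) diff_eq_iff_mat_dim, simp_all add: d)
  have rt: "r = t + z \<cdot>\<^sub>m (t * (H * (E * E) * L) * r)"
  proof -
    have "t + z \<cdot>\<^sub>m (t * M * r) = t * (1\<^sub>m N + z \<cdot>\<^sub>m (M * r))"
      by (simp add: d mat_ring)
    also have "\<dots> = t * r" using r1 by simp
    also have "\<dots> = (1\<^sub>m N + z \<cdot>\<^sub>m (t * M0)) * r" using t1 by simp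
    also have "\<dots> = r + z \<cdot>\<^sub>m (t * M0 * r)" by (simp add: d mat_ring)
    finally have "r + z \<cdot>\<^sub>m (t * M0 * r) = (t + z \<cdot>\<^sub>m (t * (H * (E * E) * L) * r)) + z \<cdot>\<^sub>m (t * M0 * r)"
      unfolding M by (simp add: d mat_ring)
    then show ?thesis by (rule add_right_cancel_mat_dim) (simp_all add: d)
  qed
  let ?w = "z \<cdot>\<^sub>m (E * E * L * t * H * E)"
  have "E * ?Psi = 1\<^sub>m m + z \<cdot>\<^sub>m (E * E * L * r * H)"
    using ED by (simp add: d mat_ring)
  also have "\<dots> = 1\<^sub>m m + z \<cdot>\<^sub>m (E * E * L * (t + z \<cdot>\<^sub>m (t * (H * (E * E) * L) * r)) * H)"
    using rt by simp
  also have "\<dots> = 1\<^sub>m m + ?w * ?Psi"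
    using ED by (simp add: d mat_ring ED')
  finally have "E * ?Psi - ?w * ?Psi = 1\<^sub>m m"
    by (subst diff_eq_iff_mat_dim) (simp_all add: d)
  then have "?V * ?Psi = 1\<^sub>m m" by (simp add: d minus_mult_distrib_mat_dim)
  moreover have Psi: "?Psi \<in> carrier_mat m m" and V: "?V \<in> carrier_mat m m" by (auto simp: d intro!: carrier_matI)
  ultimately have e: "?Psi * ?V = 1\<^sub>m m" using mat_mult_left_right_inverse[OF V Psi] by simp
  show "invertible_mat (D + z \<cdot>\<^sub>m (E * L * mat_inv (1\<^sub>m N - z \<cdot>\<^sub>m M) * H))"
    "mat_inv (D + z \<cdot>\<^sub>m (E * L * mat_inv (1\<^sub>m N - z \<cdot>\<^sub>m M) * H))
      = E - z \<cdot>\<^sub>m (E * E * L * mat_inv (1\<^sub>m N - z \<cdot>\<^sub>m M0) * H * E)"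
    using mat_inv_unique[OF Psi V e] unfolding r_def t_def by auto
qed

section \<open>Realizations as rational functions\<close>

text \<open>
  A quotient of polynomials whose denominator does not vanish at \<open>w\<close> has a finite limit there.
\<close>
lemma not_is_pole_quotient:
  assumes q: "poly q w \<noteq> 0" and f: "\<And>z. poly q z \<noteq> 0 \<Longrightarrow> f z = poly p z / poly q z"
  shows "\<not> is_pole f (w :: complex)"
proof
  assume pole: "is_pole f w"
  have lim: "((\<lambda>z. poly p z / poly q z) \<longlongrightarrow> poly p w / poly q w) (at w)"
    using q by (intro tendsto_intros) auto
  have "eventually (\<lambda>z. poly q z \<noteq> 0) (at w)"
    using q by (intro tendsto_imp_eventually_ne[of "poly q" "poly q w"] tendsto_intros)
  then have "eventually (\<lambda>z. poly p z / poly q z = f z) (at w)"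
    by eventually_elim (simp add: f)
  with lim have "(f \<longlongrightarrow> poly p w / poly q w) (at w)" by (rule Lim_transform_eventually)
  with pole show False unfolding is_pole_def
    using not_tendsto_and_filterlim_at_infinity[of "at w"] by auto
qed

text \<open>
  Cramer's rule over the polynomial ring: adjugate and determinant of the pencil \<open>1 - xM\<close> are
  computed once with polynomial entries and then evaluated at \<open>z\<close>.
\<close>
lemma mat_inv_pencil_quotient:
  assumes M: "M \<in> carrier_mat N N"
  obtains q :: "complex poly" and Adj :: "nat \<Rightarrow> nat \<Rightarrow> complex poly"
  where "\<And>z. poly q z = det (1\<^sub>m N - z \<cdot>\<^sub>m M)"
    and "\<And>z i j. poly q z \<noteq> 0 \<Longrightarrow> i < N \<Longrightarrow> j < N \<Longrightarrow>
      mat_inv (1\<^sub>m N - z \<cdot>\<^sub>m M) $$ (i,j) = poly (Adj i j) z / poly q z"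
proof -
  \<comment> \<open>The pencil \<open>1 - xM\<close> over the polynomial ring.\<close>
  define Pm where "Pm = mat N N (\<lambda>(i,j). [: 1\<^sub>m N $$ (i,j), - M $$ (i,j) :])"
  have Pm: "Pm \<in> carrier_mat N N" by (simp add: Pm_def)
  have ev: "map_mat (\<lambda>p. poly p z) Pm = 1\<^sub>m N - z \<cdot>\<^sub>m M" for z
    using M by (intro eq_matI) (auto simp: Pm_def)
  have hom: "comm_ring_hom (\<lambda>p :: complex poly. poly p z)" for z by unfold_locales auto
  then have hom': "semiring_hom (\<lambda>p :: complex poly. poly p z)" for z
    by (simp add: comm_ring_hom_def ring_hom_def)
  have q: "poly (det Pm) z = det (1\<^sub>m N - z \<cdot>\<^sub>m M)" for z
    using comm_ring_hom.hom_det[OF hom, of z Pm] by (simp add: ev)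
  note A = adj_mat[OF Pm]
  have "mat_inv (1\<^sub>m N - z \<cdot>\<^sub>m M) $$ (i,j) = poly (adj_mat Pm $$ (i,j)) z / poly (det Pm) z"
    if nz: "poly (det Pm) z \<noteq> 0" and ij: "i < N" "j < N" for z i j
  proof -
    let ?N = "1\<^sub>m N - z \<cdot>\<^sub>m M" and ?A = "map_mat (\<lambda>p. poly p z) (adj_mat Pm)"
    have Nc: "?N \<in> carrier_mat N N" and Ac: "?A \<in> carrier_mat N N" using M A(1) by auto
    have "?N * ?A = map_mat (\<lambda>p. poly p z) (Pm * adj_mat Pm)"
      using semiring_hom.mat_hom_mult[OF hom' Pm A(1), of z] by (simp add: ev)
    also have "\<dots> = poly (det Pm) z \<cdot>\<^sub>m 1\<^sub>m N" unfolding A(2) by (rule eq_matI) auto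
    finally have "?N * ?A = poly (det Pm) z \<cdot>\<^sub>m 1\<^sub>m N" .
    then have "?N * ((1 / poly (det Pm) z) \<cdot>\<^sub>m ?A) = 1\<^sub>m N"
      using nz carrier_matD[OF Nc] carrier_matD[OF Ac]
      by (simp add: mult_smult_mat_dim smult_smult_mat one_smult_mat del: index_minus_mat index_map_mat)
    then have "mat_inv ?N = (1 / poly (det Pm) z) \<cdot>\<^sub>m ?A"
      by (intro mat_inv_unique(2)[OF Nc]) (use Ac in auto)
    then show ?thesis using ij A(1) by simp
  qed
  with q show thesis by (rule that)
qed

text \<open>
  All entries share the denominator \<open>det (1 - zM)\<close>, which is nonzero as a polynomial because its
  value at \<open>0\<close> is \<open>1\<close>.
\<close>
lemma realization_quotient:
  assumes c: "K \<in> carrier_mat m m" "L \<in> carrier_mat m N" "M \<in> carrier_mat N N" "H \<in> carrier_mat N m"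
  obtains q :: "complex poly" and Num :: "nat \<Rightarrow> nat \<Rightarrow> complex poly"
  where "q \<noteq> 0" and "\<And>z. poly q z \<noteq> 0 \<longleftrightarrow> invertible_mat (1\<^sub>m N - z \<cdot>\<^sub>m M)"
    and "\<And>z i j. poly q z \<noteq> 0 \<Longrightarrow> i < m \<Longrightarrow> j < m \<Longrightarrow>
      (K + z \<cdot>\<^sub>m (L * mat_inv (1\<^sub>m N - z \<cdot>\<^sub>m M) * H)) $$ (i,j) = poly (Num i j) z / poly q z"
proof -
  obtain q :: "complex poly" and Adj
    where q: "\<And>z. poly q z = det (1\<^sub>m N - z \<cdot>\<^sub>m M)"
      and Adj: "\<And>z i j. poly q z \<noteq> 0 \<Longrightarrow> i < N \<Longrightarrow> j < N \<Longrightarrow>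
        mat_inv (1\<^sub>m N - z \<cdot>\<^sub>m M) $$ (i,j) = poly (Adj i j) z / poly q z"
    using mat_inv_pencil_quotient[OF c(3)] by blast
  have Nc: "1\<^sub>m N - z \<cdot>\<^sub>m M \<in> carrier_mat N N" for z using c by auto
  have inv: "poly q z \<noteq> 0 \<longleftrightarrow> invertible_mat (1\<^sub>m N - z \<cdot>\<^sub>m M)" for z
    using invertible_mat_iff_det[OF Nc] q by simp
  define Num where "Num i j = Polynomial.smult (K $$ (i,j)) q
    + [:0,1:] * (\<Sum>k<N. (\<Sum>l<N. Polynomial.smult (L $$ (i,l)) (Adj l k)) * [: H $$ (k,j) :])" for i j
  have 1: "(K + z \<cdot>\<^sub>m (L * mat_inv (1\<^sub>m N - z \<cdot>\<^sub>m M) * H)) $$ (i,j) = poly (Num i j) z / poly q z"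
    if nz: "poly q z \<noteq> 0" and ij: "i < m" "j < m" for z i j
  proof -
    note I = mat_inv(1)[OF Nc inv[THEN iffD1, OF nz]]
    have "(K + z \<cdot>\<^sub>m (L * mat_inv (1\<^sub>m N - z \<cdot>\<^sub>m M) * H)) $$ (i,j) = K $$ (i,j)
        + z * (\<Sum>k<N. (\<Sum>l<N. L $$ (i,l) * mat_inv (1\<^sub>m N - z \<cdot>\<^sub>m M) $$ (l,k)) * H $$ (k,j))"
      using c ij carrier_matD[OF I] by (simp add: scalar_prod_def atLeast0LessThan)
    also have "\<dots> = K $$ (i,j)
        + z * (\<Sum>k<N. (\<Sum>l<N. L $$ (i,l) * (poly (Adj l k) z / poly q z)) * H $$ (k,j))"
      using nz by (simp add: Adj)
    also have "\<dots> = poly (Num i j) z / poly q z"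
      using nz by (simp add: Num_def poly_sum add_divide_distrib sum_divide_distrib sum_distrib_right
          sum_distrib_left mult.commute mult.left_commute)
    finally show ?thesis .
  qed
  have "1\<^sub>m N - 0 \<cdot>\<^sub>m M = 1\<^sub>m N" using c by (intro eq_matI) auto
  then have "poly q 0 \<noteq> 0" by (simp add: q)
  then have "q \<noteq> 0" by auto
  with inv 1 show thesis using that by blast
qed

text \<open>
  Poles of the function can only be zeros of \<open>det (1 - zM)\<close>, and poles of its inverse only zeros
  of \<open>det (1 - zM) det (1 - zM')\<close>: away from these the inverse is given by its own realization.
  Both determinants have no zeros in the closed disc.
\<close>
lemma invertible_outer_realization:
  assumes c: "D \<in> carrier_mat m m" "L \<in> carrier_mat m N" "M \<in> carrier_mat N N" "H \<in> carrier_mat N m"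
    "D' \<in> carrier_mat m m" "L' \<in> carrier_mat m N" "M' \<in> carrier_mat N N" "H' \<in> carrier_mat N m"
  defines "\<Psi> \<equiv> \<lambda>z. D + z \<cdot>\<^sub>m (L * mat_inv (1\<^sub>m N - z \<cdot>\<^sub>m M) * H)"
  assumes inv: "\<And>z. cmod z \<le> 1 \<Longrightarrow> invertible_mat (1\<^sub>m N - z \<cdot>\<^sub>m M)"
    "\<And>z. cmod z \<le> 1 \<Longrightarrow> invertible_mat (1\<^sub>m N - z \<cdot>\<^sub>m M')"
    and Psi: "\<And>z. invertible_mat (1\<^sub>m N - z \<cdot>\<^sub>m M) \<Longrightarrow> invertible_mat (1\<^sub>m N - z \<cdot>\<^sub>m M') \<Longrightarrow>
      invertible_mat (\<Psi> z) \<and> mat_inv (\<Psi> z) = D' + z \<cdot>\<^sub>m (L' * mat_inv (1\<^sub>m N - z \<cdot>\<^sub>m M') * H')"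
  shows "invertible_outer m \<Psi>"
proof -
  obtain q Num where q0: "q \<noteq> 0" and q: "\<And>z. poly q z \<noteq> 0 \<longleftrightarrow> invertible_mat (1\<^sub>m N - z \<cdot>\<^sub>m M)"
    and Num: "\<And>z i j. poly q z \<noteq> 0 \<Longrightarrow> i < m \<Longrightarrow> j < m \<Longrightarrow> \<Psi> z $$ (i,j) = poly (Num i j) z / poly q z"
    using realization_quotient[OF c(1-4)] unfolding \<Psi>_def by blast
  obtain q' Num' where q0': "q' \<noteq> 0" and q': "\<And>z. poly q' z \<noteq> 0 \<longleftrightarrow> invertible_mat (1\<^sub>m N - z \<cdot>\<^sub>m M')"
    and Num': "\<And>z i j. poly q' z \<noteq> 0 \<Longrightarrow> i < m \<Longrightarrow> j < m \<Longrightarrow>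
      (D' + z \<cdot>\<^sub>m (L' * mat_inv (1\<^sub>m N - z \<cdot>\<^sub>m M') * H')) $$ (i,j) = poly (Num' i j) z / poly q' z"
    using realization_quotient[OF c(5-8)] by blast
  have "\<Psi> z \<in> carrier_mat m m" for z
    unfolding \<Psi>_def using c by (intro carrier_matI) auto
  then have "rational_mat_fun m \<Psi>"
    unfolding rational_mat_fun_def rational_fun_def using q0 Num by blast
  moreover have "no_poles_on m \<Psi> (cball 0 1)"
    unfolding no_poles_on_def is_mat_pole_def
  proof safe
    fix w i j assume w: "w \<in> cball (0::complex) 1" and ij: "i < m" "j < m" and pole: "is_pole (\<lambda>z. \<Psi> z $$ (i,j)) w"
    have "poly q w \<noteq> 0" using q inv(1) w by simp
    then have "\<not> is_pole (\<lambda>z. \<Psi> z $$ (i,j)) w" by (rule not_is_pole_quotient) (rule Num[OF _ ij])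
    with pole show False by simp
  qed
  moreover have "finite {z. \<not> invertible_mat (\<Psi> z)}"
  proof (rule finite_subset)
    show "{z. \<not> invertible_mat (\<Psi> z)} \<subseteq> {z. poly (q * q') z = 0}" using Psi q q' by auto
    show "finite {z. poly (q * q') z = 0}" using q0 q0' by (intro poly_roots_finite) auto
  qed
  moreover have "no_poles_on m (\<lambda>z. mat_inv (\<Psi> z)) (cball 0 1)"
    unfolding no_poles_on_def is_mat_pole_def
  proof safe
    fix w i j assume w: "w \<in> cball (0::complex) 1" and ij: "i < m" "j < m"
      and pole: "is_pole (\<lambda>z. mat_inv (\<Psi> z) $$ (i,j)) w"
    have "poly (q * q') w \<noteq> 0" using q q' inv w by simp
    then have "\<not> is_pole (\<lambda>z. mat_inv (\<Psi> z) $$ (i,j)) w"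
    proof (rule not_is_pole_quotient)
      fix z assume nz: "poly (q * q') z \<noteq> 0"
      then have "mat_inv (\<Psi> z) = D' + z \<cdot>\<^sub>m (L' * mat_inv (1\<^sub>m N - z \<cdot>\<^sub>m M') * H')"
        using Psi q q' by simp
      then show "mat_inv (\<Psi> z) $$ (i,j) = poly (q * Num' i j) z / poly (q * q') z"
        using Num'[OF _ ij, of z] nz by simp
    qed
    with pole show False by simp
  qed
  ultimately show ?thesis by (simp add: invertible_outer_def no_zeros_on_def)
qed

section \<open>Spectral factorization\<close>

lemma realization_eq_resolvent:
  assumes M: "M \<in> carrier_mat k k" and L: "dim_col L = k" and H: "dim_row H = k"
    and z: "z \<noteq> 0" and inv: "invertible_mat (1\<^sub>m k - z \<cdot>\<^sub>m M)"
  shows "z \<cdot>\<^sub>m (L * mat_inv (1\<^sub>m k - z \<cdot>\<^sub>m M) * H) = L * resolvent (1 / z) M * H"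
proof -
  have "1\<^sub>m k - z \<cdot>\<^sub>m M \<in> carrier_mat k k" using M by auto
  note d = carrier_matD[OF mat_inv(1)[OF this inv]] carrier_matD[OF M] L H
  show ?thesis unfolding resolvent_inverse_point(2)[OF M z inv, symmetric] by (simp add: d mat_ring)
qed

lemma mat_inv_square:
  assumes D: "D \<in> carrier_mat k k" and inv: "invertible_mat D"
  shows "mat_inv (D * D) = mat_inv D * mat_inv D"
proof (rule mat_inv_unique(2))
  note I = mat_inv[OF D inv]
  note d = carrier_matD[OF D] carrier_matD[OF I(1)]
  show "D * D \<in> carrier_mat k k" "mat_inv D * mat_inv D \<in> carrier_mat k k"
    using d by (auto intro: carrier_matI)
  have "D * D * (mat_inv D * mat_inv D) = D * (D * mat_inv D) * mat_inv D"
    by (simp only: d assoc_mult_mat_dim index_mult_mat)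
  then show "D * D * (mat_inv D * mat_inv D) = 1\<^sub>m k"
    using I d by (simp add: right_mult_one_mat_dim)
qed

theorem proposition2p3:
  fixes m n p :: nat
    and R0 A B C \<alpha> \<beta> \<gamma> Pplus Pminus At Bt Ct Dt Q D A0 B0 C0 :: "complex mat"
    and R \<Psi> :: "complex \<Rightarrow> complex mat"
  assumes "R0 \<in> carrier_mat m m"
    and "A \<in> carrier_mat n n" and "B \<in> carrier_mat n m" and "C \<in> carrier_mat m n"
    and "\<alpha> \<in> carrier_mat p p" and "\<beta> \<in> carrier_mat p m" and "\<gamma> \<in> carrier_mat m p"
    and "stable_mat A" and "stable_mat \<alpha>"
    and R_def: "R = (\<lambda>z. R0 + z \<cdot>\<^sub>m (C * mat_inv (1\<^sub>m n - z \<cdot>\<^sub>m A) * B)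
                             + \<gamma> * mat_inv (z \<cdot>\<^sub>m 1\<^sub>m p - \<alpha>) * \<beta>)"
    and "no_poles_on m R (sphere 0 1)" and "no_zeros_on m R (sphere 0 1)"
    and "Pplus \<in> carrier_mat n n" and "Pplus - A\<^sup>\<dagger> * Pplus * A = C\<^sup>\<dagger> * C"
    and "Pminus \<in> carrier_mat p p" and "Pminus - \<alpha>\<^sup>\<dagger> * Pminus * \<alpha> = \<gamma>\<^sup>\<dagger> * \<gamma>"
    and At_def: "At = four_block_mat (A\<^sup>\<dagger>) (C\<^sup>\<dagger> * \<gamma>) (0\<^sub>m p n) \<alpha>"
    and Bt_def: "Bt = (C\<^sup>\<dagger> * R0 + A\<^sup>\<dagger> * Pplus * B) @\<^sub>r \<beta>"
    and Ct_def: "Ct = hstack (B\<^sup>\<dagger>) (R0\<^sup>\<dagger> * \<gamma> + \<beta>\<^sup>\<dagger> * Pminus * \<alpha>)"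
    and Dt_def: "Dt = R0\<^sup>\<dagger> * R0 + B\<^sup>\<dagger> * Pplus * B + \<beta>\<^sup>\<dagger> * Pminus * \<beta>"
    and "stabilizing_solution At Bt Ct Dt Q"
    and D_sqrt: "D \<in> carrier_mat m m" "pos_def_mat D" "D * D = Dt - Ct * Q * Ct\<^sup>\<dagger>"
    and C0_def: "C0 = Bt\<^sup>\<dagger> - Ct * Q * At\<^sup>\<dagger>"
    and B0_def: "B0 = Ct\<^sup>\<dagger>"
    and A0_def: "A0 = At\<^sup>\<dagger> - Ct\<^sup>\<dagger> * (mat_inv D ^\<^sub>m 2) * C0"
    and Psi_def: "\<Psi> = (\<lambda>z. D + z \<cdot>\<^sub>m (mat_inv D * C0 * mat_inv (1\<^sub>m (n + p) - z \<cdot>\<^sub>m At\<^sup>\<dagger>) * B0))"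
  shows "stable_mat A0
    \<and> (\<forall>z. z \<noteq> 0 \<and>
           (\<forall>w \<in> {z, 1 / cnj z}.
              invertible_mat (1\<^sub>m n - w \<cdot>\<^sub>m A) \<and> invertible_mat (w \<cdot>\<^sub>m 1\<^sub>m p - \<alpha>)) \<longrightarrow>
           para_adjoint R z * R z = para_adjoint \<Psi> z * \<Psi> z)
    \<and> invertible_outer m \<Psi>
    \<and> (\<forall>z. invertible_mat (1\<^sub>m (n + p) - z \<cdot>\<^sub>m At\<^sup>\<dagger>) \<and>
           invertible_mat (1\<^sub>m (n + p) - z \<cdot>\<^sub>m A0) \<longrightarrow>
           invertible_mat (\<Psi> z) \<and>
           mat_inv (\<Psi> z) = mat_inv D - z \<cdot>\<^sub>m
             ((mat_inv D ^\<^sub>m 2) * C0 * mat_inv (1\<^sub>m (n + p) - z \<cdot>\<^sub>m A0) * B0 * mat_inv D))"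
proof -
  note c = assms(1-7)
  have P: "Pplus \<in> carrier_mat n n" and P': "Pminus \<in> carrier_mat p p" by fact+
  have CC: "C\<^sup>\<dagger> * C \<in> carrier_mat n n" "(C\<^sup>\<dagger> * C)\<^sup>\<dagger> = C\<^sup>\<dagger> * C"
    and gg: "\<gamma>\<^sup>\<dagger> * \<gamma> \<in> carrier_mat p p" "(\<gamma>\<^sup>\<dagger> * \<gamma>)\<^sup>\<dagger> = \<gamma>\<^sup>\<dagger> * \<gamma>"
    using c by (auto simp: adjoint_mult intro!: carrier_matI)
  have Ph: "Pplus\<^sup>\<dagger> = Pplus" using stein_equation_hermitian[OF c(2) assms(8) P CC] assms by blast
  have P'h: "Pminus\<^sup>\<dagger> = Pminus" using stein_equation_hermitian[OF c(5) assms(9) P' gg] assms by blast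
  note d0 = c[THEN carrier_matD(1)] c[THEN carrier_matD(2)] carrier_matD[OF P] carrier_matD[OF P']
    carrier_matD[OF D_sqrt(1)]
  have At: "At \<in> carrier_mat (n + p) (n + p)" and Bt: "Bt \<in> carrier_mat (n + p) m"
    and Ct: "Ct \<in> carrier_mat m (n + p)" and Dt: "Dt \<in> carrier_mat m m"
    unfolding At_def Bt_def Ct_def Dt_def by (auto simp: d0 intro!: carrier_matI)
  have Q: "Q \<in> carrier_mat (n + p) (n + p)" "Q\<^sup>\<dagger> = Q"
    using assms(21) At by (auto simp: stabilizing_solution_def)
  define E where "E = mat_inv D"
  have Dinv: "invertible_mat D" by (rule pos_def_mat_invertible[OF D_sqrt(1,2)])
  note E = mat_inv[OF D_sqrt(1) Dinv, folded E_def]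
  have Dh: "D\<^sup>\<dagger> = D" using D_sqrt(2) by (simp add: pos_def_mat_def)
  have Eh: "E\<^sup>\<dagger> = E" using adjoint_mat_inv(2)[OF D_sqrt(1) Dinv] by (simp add: E_def Dh)
  have E2: "mat_inv D ^\<^sub>m 2 = E * E"
    using E(1) by (simp add: numeral_2_eq_2 E_def[symmetric])
  have EE: "mat_inv (Dt - Ct * Q * Ct\<^sup>\<dagger>) = E * E"
    unfolding D_sqrt(3)[symmetric] E_def by (rule mat_inv_square[OF D_sqrt(1) Dinv])
  note d = d0 carrier_matD[OF At] carrier_matD[OF Bt] carrier_matD[OF Ct] carrier_matD[OF Dt]
    carrier_matD[OF Q(1)] carrier_matD[OF E(1)]
  have C0: "C0 \<in> carrier_mat m (n + p)" and B0: "B0 \<in> carrier_mat (n + p) m"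
    and A0: "A0 \<in> carrier_mat (n + p) (n + p)"
    unfolding C0_def B0_def A0_def E2 by (auto simp: d intro!: carrier_matI)
  have C0h: "C0\<^sup>\<dagger> = Bt - At * Q * Ct\<^sup>\<dagger>"
    unfolding C0_def by (simp add: d adjoint_ring Q(2) assoc_mult_mat_dim)
  have A0E: "A0 = At\<^sup>\<dagger> - B0 * (E * E) * C0" unfolding A0_def B0_def E2 ..
  have st: "stable_mat A0" and ric: "Q - At * Q * At\<^sup>\<dagger> = C0\<^sup>\<dagger> * (E * E) * C0"
    using assms(21) unfolding stabilizing_solution_def EE A0_def E2 C0h C0_def[symmetric] by auto

  have rpAt: "resolvent_point (1 / z) (At\<^sup>\<dagger>)"
    if "resolvent_point (1 / z) A" "resolvent_point (1 / cnj z) \<alpha>" for z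
  proof -
    have "resolvent_point (1 / cnj z) (A\<^sup>\<dagger>)" using resolvent_adjoint(1)[OF that(1)] by simp
    then have "resolvent_point (1 / cnj z) At" unfolding At_def
      \<comment> \<open>The claim is about invertibility alone, so empty flanking matrices will do.\<close>
      by (rule resolvent_block_upper(1)[of _ _ n _ p _ "0\<^sub>m 0 n" 0 "0\<^sub>m 0 p" "0\<^sub>m n 0" 0 "0\<^sub>m p 0"])
        (use c that in \<open>auto simp: d intro!: carrier_matI\<close>)
    from resolvent_adjoint(1)[OF this] show ?thesis by simp
  qed

  have factor: "para_adjoint R z * R z = para_adjoint \<Psi> z * \<Psi> z"
    if z: "z \<noteq> 0" and zinv: "\<forall>w \<in> {z, 1 / cnj z}.
      invertible_mat (1\<^sub>m n - w \<cdot>\<^sub>m A) \<and> invertible_mat (w \<cdot>\<^sub>m 1\<^sub>m p - \<alpha>)" for z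
  proof -
    define u w where "u = 1 / z" and "w = 1 / cnj z"
    have w: "w \<noteq> 0" "1 / w = cnj z" "cnj w = u" "1 / cnj z = w" "cnj u = w" "z * u = 1"
      using z by (simp_all add: u_def w_def)
    have inv: "invertible_mat (1\<^sub>m n - z \<cdot>\<^sub>m A)" "invertible_mat (1\<^sub>m n - w \<cdot>\<^sub>m A)"
      using zinv by (auto simp: w_def)
    \<comment> \<open>\<open>R(z)\<close> involves the resolvents of \<open>A\<close> at \<open>1/z\<close> and of \<open>\<alpha>\<close> at \<open>z\<close>; \<open>R(w)\<close> those of \<open>A\<close> at
      \<open>1/w = cnj z\<close> and of \<open>\<alpha>\<close> at \<open>w\<close>. Adjoints turn the latter into resolvents at \<open>z\<close> and \<open>1/z\<close>.\<close>
    have rp: "resolvent_point u A" "resolvent_point (cnj z) A" "resolvent_point z \<alpha>" "resolvent_point w \<alpha>"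
    proof -
      show "resolvent_point u A" using resolvent_inverse_point(1)[OF c(2) z] inv(1) by (simp add: u_def)
      show "resolvent_point (cnj z) A" using resolvent_inverse_point(1)[OF c(2) w(1)] inv(2) w(2) by simp
      have "invertible_mat (z \<cdot>\<^sub>m 1\<^sub>m p - \<alpha>)" "invertible_mat (w \<cdot>\<^sub>m 1\<^sub>m p - \<alpha>)"
        using zinv by (simp_all add: w_def)
      then show "resolvent_point z \<alpha>" "resolvent_point w \<alpha>" by (simp_all add: resolvent_point_def d0)
    qed
    have rp': "resolvent_point z (A\<^sup>\<dagger>)" "resolvent_point u (\<alpha>\<^sup>\<dagger>)" "resolvent_point w (A\<^sup>\<dagger>)"
      using resolvent_adjoint(1)[OF rp(2)] resolvent_adjoint(1)[OF rp(4)] resolvent_adjoint(1)[OF rp(1)] w(3,5)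
      by simp_all
    note block = resolvent_block_upper[where E = "C\<^sup>\<dagger> * \<gamma>" and n = n and p = p and a = m and b = m
        and X = "B\<^sup>\<dagger>" and Y = "R0\<^sup>\<dagger> * \<gamma> + \<beta>\<^sup>\<dagger> * Pminus * \<alpha>"
        and U = "C\<^sup>\<dagger> * R0 + A\<^sup>\<dagger> * Pplus * B" and V = \<beta> and F = "A\<^sup>\<dagger>" and G = \<alpha>, folded At_def Bt_def Ct_def]
    have side: "A\<^sup>\<dagger> \<in> carrier_mat n n" "\<alpha> \<in> carrier_mat p p" "C\<^sup>\<dagger> * \<gamma> \<in> carrier_mat n p" "B\<^sup>\<dagger> \<in> carrier_mat m n"
      "R0\<^sup>\<dagger> * \<gamma> + \<beta>\<^sup>\<dagger> * Pminus * \<alpha> \<in> carrier_mat m p" "C\<^sup>\<dagger> * R0 + A\<^sup>\<dagger> * Pplus * B \<in> carrier_mat n m"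
      "\<beta> \<in> carrier_mat p m"
      using c by (auto simp: d intro!: carrier_matI)
    note bz = block[OF rp'(1) side(1) rp(3) side(2-7)] and bw = block[OF rp'(3) side(1) rp(4) side(2-7)]
    have rpT: "resolvent_point z At" "resolvent_point w At" "resolvent_point u (At\<^sup>\<dagger>)" "resolvent_point (cnj z) (At\<^sup>\<dagger>)"
      using bz(1) bw(1) resolvent_adjoint(1)[OF bz(1)] resolvent_adjoint(1)[OF bw(1)] w(3) by simp_all
    note rd = resolvent_dims(1,2)[OF rp(1)] resolvent_dims(1,2)[OF rp(2)] resolvent_dims(1,2)[OF rp(3)]
      resolvent_dims(1,2)[OF rp(4)] resolvent_dims(1,2)[OF rp'(1)] resolvent_dims(1,2)[OF rp'(2)]
      resolvent_dims(1,2)[OF rp'(3)]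
      resolvent_dims(1,2)[OF rpT(1)] resolvent_dims(1,2)[OF rpT(2)] resolvent_dims(1,2)[OF rpT(3)]
      resolvent_dims(1,2)[OF rpT(4)]
    have ra: "(resolvent (cnj z) A)\<^sup>\<dagger> = resolvent z (A\<^sup>\<dagger>)" "(resolvent w \<alpha>)\<^sup>\<dagger> = resolvent u (\<alpha>\<^sup>\<dagger>)"
      "(resolvent w (A\<^sup>\<dagger>))\<^sup>\<dagger> = resolvent u A"
      "(resolvent (cnj z) (At\<^sup>\<dagger>))\<^sup>\<dagger> = resolvent z At" "(resolvent w At)\<^sup>\<dagger> = resolvent u (At\<^sup>\<dagger>)"
      using resolvent_adjoint(2)[OF rp(2)] resolvent_adjoint(2)[OF rp(4)] resolvent_adjoint(2)[OF rp'(3)]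
        resolvent_adjoint(2)[OF rpT(4)] resolvent_adjoint(2)[OF rpT(2)] w(3,5) by simp_all
    have Rz: "R z = R0 + C * resolvent u A * B + \<gamma> * resolvent z \<alpha> * \<beta>"
      unfolding R_def using realization_eq_resolvent[OF c(2) _ _ z inv(1), of C B]
      by (simp add: u_def resolvent_def d)
    have Rw: "R w = R0 + C * resolvent (cnj z) A * B + \<gamma> * resolvent w \<alpha> * \<beta>"
      unfolding R_def using realization_eq_resolvent[OF c(2) _ _ w(1) inv(2), of C B]
      by (simp add: w(2) resolvent_def d)
    have "para_adjoint R z = R0\<^sup>\<dagger> + B\<^sup>\<dagger> * resolvent z (A\<^sup>\<dagger>) * C\<^sup>\<dagger> + \<beta>\<^sup>\<dagger> * resolvent u (\<alpha>\<^sup>\<dagger>) * \<gamma>\<^sup>\<dagger>"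
      unfolding para_adjoint_def w(4) Rw by (simp add: d rd adjoint_ring ra assoc_mult_mat_dim)
    then have "para_adjoint R z * R z = Dt + Ct * resolvent z At * Bt
      + (((R0\<^sup>\<dagger> * C + B\<^sup>\<dagger> * Pplus * A) + \<beta>\<^sup>\<dagger> * resolvent u (\<alpha>\<^sup>\<dagger>) * \<gamma>\<^sup>\<dagger> * C) * resolvent u A * B
          + \<beta>\<^sup>\<dagger> * resolvent u (\<alpha>\<^sup>\<dagger>) * (\<gamma>\<^sup>\<dagger> * R0 + \<alpha>\<^sup>\<dagger> * Pminus * \<beta>))"
      unfolding Rz bz(2) Dt_def
      by (simp only:)
        (rule two_sided_gram[OF c P P' _ _ w(6) rp'(1) rp(1) rp(3) rp'(2)],
          use assms(14,16) in \<open>simp_all add: d diff_eq_iff_mat_dim\<close>)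
    \<comment> \<open>The part in \<open>1/z\<close> is the para-adjoint of the part in \<open>z\<close>; this is where \<open>Pplus\<close> and \<open>Pminus\<close>
      have to be Hermitian.\<close>
    also have "(((R0\<^sup>\<dagger> * C + B\<^sup>\<dagger> * Pplus * A) + \<beta>\<^sup>\<dagger> * resolvent u (\<alpha>\<^sup>\<dagger>) * \<gamma>\<^sup>\<dagger> * C) * resolvent u A * B
          + \<beta>\<^sup>\<dagger> * resolvent u (\<alpha>\<^sup>\<dagger>) * (\<gamma>\<^sup>\<dagger> * R0 + \<alpha>\<^sup>\<dagger> * Pminus * \<beta>)) = (Ct * resolvent w At * Bt)\<^sup>\<dagger>"
      unfolding bw(2) by (simp add: d rd adjoint_ring ra Ph P'h assoc_mult_mat_dim)
    also have "\<dots> = Bt\<^sup>\<dagger> * resolvent u (At\<^sup>\<dagger>) * Ct\<^sup>\<dagger>"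
      by (simp add: d rd adjoint_ring ra assoc_mult_mat_dim)
    finally have RR: "para_adjoint R z * R z
      = Dt + Ct * resolvent z At * Bt + Bt\<^sup>\<dagger> * resolvent u (At\<^sup>\<dagger>) * Ct\<^sup>\<dagger>" .
    have invT: "invertible_mat (1\<^sub>m (n + p) - z \<cdot>\<^sub>m At\<^sup>\<dagger>)" "invertible_mat (1\<^sub>m (n + p) - w \<cdot>\<^sub>m At\<^sup>\<dagger>)"
      using resolvent_inverse_point(1)[OF adjoint_carrier[OF At] z]
        resolvent_inverse_point(1)[OF adjoint_carrier[OF At] w(1)] rpT(3,4) w(2)
      by (simp_all add: u_def)
    have Pz: "\<Psi> z = D + E * C0 * resolvent u (At\<^sup>\<dagger>) * Ct\<^sup>\<dagger>"
      unfolding Psi_def using realization_eq_resolvent[OF adjoint_carrier[OF At] _ _ z invT(1), of "E * C0" B0] C0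
      by (simp add: u_def E_def B0_def d)
    have Pw: "\<Psi> w = D + E * C0 * resolvent (cnj z) (At\<^sup>\<dagger>) * Ct\<^sup>\<dagger>"
      unfolding Psi_def using realization_eq_resolvent[OF adjoint_carrier[OF At] _ _ w(1) invT(2), of "E * C0" B0] C0
      by (simp add: w(2) E_def B0_def d)
    have "para_adjoint \<Psi> z = D + Ct * resolvent z At * (C0\<^sup>\<dagger> * E)"
      unfolding para_adjoint_def w(4) Pw using carrier_matD[OF C0]
      by (simp add: d rd adjoint_ring ra Dh Eh assoc_mult_mat_dim)
    then have "para_adjoint \<Psi> z * \<Psi> z
      = Dt + Ct * resolvent z At * Bt + Bt\<^sup>\<dagger> * resolvent u (At\<^sup>\<dagger>) * Ct\<^sup>\<dagger>"
      unfolding Pz using riccati_factor_gram[OF At Bt Ct Dt Q(1) D_sqrt(1) E(1) C0 D_sqrt(3) E(3,2)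
          C0_def C0h ric w(6) rpT(1,3)] by simp
    with RR show ?thesis by simp
  qed

  have invA: "invertible_mat (1\<^sub>m (n + p) - z \<cdot>\<^sub>m At\<^sup>\<dagger>)" if z: "cmod z \<le> 1" for z
  proof (cases "z = 0")
    case True
    have "1\<^sub>m (n + p) - 0 \<cdot>\<^sub>m At\<^sup>\<dagger> = 1\<^sub>m (n + p)" by (rule eq_matI) (auto simp: d)
    with True show ?thesis using invertible_mat_iff_det[OF one_carrier_mat, where 'a = complex] by simp
  next
    case False
    have "resolvent_point (1 / z) A"
      using resolvent_inverse_point(1)[OF c(2) False] stable_mat_invertible[OF c(2) assms(8) z] by simp
    moreover have "resolvent_point (1 / cnj z) \<alpha>"
      using resolvent_inverse_point(1)[OF c(5), of "cnj z"] stable_mat_invertible[OF c(5) assms(9), of "cnj z"] z False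
      by simp
    ultimately have "resolvent_point (1 / z) (At\<^sup>\<dagger>)" by (rule rpAt)
    then show ?thesis using resolvent_inverse_point(1)[OF adjoint_carrier[OF At] False] by simp
  qed

  have inverse: "invertible_mat (\<Psi> z) \<and> mat_inv (\<Psi> z) = E - z \<cdot>\<^sub>m
      (E * E * C0 * mat_inv (1\<^sub>m (n + p) - z \<cdot>\<^sub>m A0) * B0 * E)"
    if "invertible_mat (1\<^sub>m (n + p) - z \<cdot>\<^sub>m At\<^sup>\<dagger>)" "invertible_mat (1\<^sub>m (n + p) - z \<cdot>\<^sub>m A0)" for z
    using realization_inverse[OF D_sqrt(1) adjoint_carrier[OF At] B0 C0 E(1,2) A0E that]
    unfolding Psi_def E_def by simp

  have outer: "invertible_outer m \<Psi>"
    unfolding Psi_def E_def[symmetric]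
  proof (rule invertible_outer_realization[where D' = E and L' = "(-1) \<cdot>\<^sub>m (E * E * C0)" and M' = A0 and H' = "B0 * E"])
    show "invertible_mat (1\<^sub>m (n + p) - z \<cdot>\<^sub>m A0)" if "cmod z \<le> 1" for z
      by (rule stable_mat_invertible[OF A0 st that])
    fix z assume inv: "invertible_mat (1\<^sub>m (n + p) - z \<cdot>\<^sub>m At\<^sup>\<dagger>)" "invertible_mat (1\<^sub>m (n + p) - z \<cdot>\<^sub>m A0)"
    have "1\<^sub>m (n + p) - z \<cdot>\<^sub>m A0 \<in> carrier_mat (n + p) (n + p)" using A0 by auto
    note dI = carrier_matD[OF mat_inv(1)[OF this inv(2)]] carrier_matD[OF C0] carrier_matD[OF B0]
    \<comment> \<open>The inverse in the shape \<open>D' + z L' (1 - z M')\<^bsup>-1\<^esup> H'\<close>, the minus sign being absorbed in \<open>L'\<close>.\<close>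
    have "E - z \<cdot>\<^sub>m (E * E * C0 * mat_inv (1\<^sub>m (n + p) - z \<cdot>\<^sub>m A0) * B0 * E)
      = E + z \<cdot>\<^sub>m ((-1) \<cdot>\<^sub>m (E * E * C0 * mat_inv (1\<^sub>m (n + p) - z \<cdot>\<^sub>m A0) * B0 * E))"
      by (rule eq_matI) (simp_all add: d dI del: index_mult_mat(1))
    also have "\<dots> = E + z \<cdot>\<^sub>m (((-1) \<cdot>\<^sub>m (E * E * C0)) * mat_inv (1\<^sub>m (n + p) - z \<cdot>\<^sub>m A0) * (B0 * E))"
      by (simp add: d dI smult_mult_mat_dim assoc_mult_mat_dim)
    finally have e: "E - z \<cdot>\<^sub>m (E * E * C0 * mat_inv (1\<^sub>m (n + p) - z \<cdot>\<^sub>m A0) * B0 * E)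
      = E + z \<cdot>\<^sub>m (((-1) \<cdot>\<^sub>m (E * E * C0)) * mat_inv (1\<^sub>m (n + p) - z \<cdot>\<^sub>m A0) * (B0 * E))" .
    show "invertible_mat (D + z \<cdot>\<^sub>m (E * C0 * mat_inv (1\<^sub>m (n + p) - z \<cdot>\<^sub>m At\<^sup>\<dagger>) * B0)) \<and>
      mat_inv (D + z \<cdot>\<^sub>m (E * C0 * mat_inv (1\<^sub>m (n + p) - z \<cdot>\<^sub>m At\<^sup>\<dagger>) * B0)) =
      E + z \<cdot>\<^sub>m (((-1) \<cdot>\<^sub>m (E * E * C0)) * mat_inv (1\<^sub>m (n + p) - z \<cdot>\<^sub>m A0) * (B0 * E))"
      using inverse[OF inv] unfolding e unfolding Psi_def E_def[symmetric] .
  next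
    show "E * C0 \<in> carrier_mat m (n + p)" "(-1) \<cdot>\<^sub>m (E * E * C0) \<in> carrier_mat m (n + p)"
      "B0 * E \<in> carrier_mat (n + p) m"
      using carrier_matD[OF C0] carrier_matD[OF B0] by (auto simp: d intro!: carrier_matI)
  qed (fact D_sqrt(1) adjoint_carrier[OF At] B0 E(1) A0 invA)+

  show ?thesis
    unfolding E2 unfolding E_def[symmetric]
  proof (intro conjI allI impI)
    fix z assume "z \<noteq> 0 \<and> (\<forall>w \<in> {z, 1 / cnj z}.
      invertible_mat (1\<^sub>m n - w \<cdot>\<^sub>m A) \<and> invertible_mat (w \<cdot>\<^sub>m 1\<^sub>m p - \<alpha>))"
    then show "para_adjoint R z * R z = para_adjoint \<Psi> z * \<Psi> z" using factor[of z] by blast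
  next
    fix z assume "invertible_mat (1\<^sub>m (n + p) - z \<cdot>\<^sub>m At\<^sup>\<dagger>) \<and> invertible_mat (1\<^sub>m (n + p) - z \<cdot>\<^sub>m A0)"
    then have "invertible_mat (1\<^sub>m (n + p) - z \<cdot>\<^sub>m At\<^sup>\<dagger>)" "invertible_mat (1\<^sub>m (n + p) - z \<cdot>\<^sub>m A0)" by auto
    note i = inverse[OF this]
    show "invertible_mat (\<Psi> z)" using i by (rule conjunct1)
    show "mat_inv (\<Psi> z) = E - z \<cdot>\<^sub>m (E * E * C0 * mat_inv (1\<^sub>m (n + p) - z \<cdot>\<^sub>m A0) * B0 * E)"
      using i by (rule conjunct2)
  qed (fact st outer)+
qed

end
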